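(* Let $N\ge 1$ be an integer, let $\sigma_\xi>0$, and let $\boldsymbol{\xi}_N=(\xi_{-N},\dots,\xi_N)$ be a jointly Gaussian random vector, with any correlation structure, whose components each have mean $0$ and variance $\sigma_\xi^2$. Let $\mathbf{A}^{(N)}$ be the random $(2N+1)\times(2N+1)$ matrix with entries $$(\mathbf{A}^{(N)})_{mn}=\operatorname{sinc}(m-n+\xi_m),\qquad -N\le m,n\le N.$$ Let $\epsilon\in(0,1)$, $\eta\in(0,1)$ and $c:=\log(2-\epsilon)/\pi$, and assume that $$1-\sqrt{\frac{8}{\pi}}\,\frac{e^{-c^2/(2\sigma_\xi^2)}}{\frac{c}{\sigma_\xi}+\sqrt{\frac{c^2}{\sigma_\xi^2}+2}}>0 .$$ If $$N\le\frac12\left[\frac{\log(1-\eta)}{\log\left(1-\sqrt{\frac{8}{\pi}}\,\dfrac{e^{-c^2/(2\sigma_\xi^2)}}{\frac{c}{\sigma_\xi}+\sqrt{\frac{c^2}{\sigma_\xi^2}+2}}\right)}-1\right],$$ then $\sigma_{\min}(\mathbf{A}^{(N)})\ge\epsilon$ with probability at least $1-\eta$.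
   Context: $\operatorname{sinc}(x)=\sin(\pi x)/(\pi x)$ for $x\ne0$ and $\operatorname{sinc}(0)=1$. $\sigma_{\min}(\mathbf{A})$ denotes the smallest singular value of $\mathbf{A}$. $\log$ is the natural logarithm. *)

theory Defs
  imports "HOL-Probability.Probability" "Jordan_Normal_Form.Char_Poly"
begin

text \<open>The normalised sinc function; the \<open>sinc\<close> of \<open>HOL-Probability\<close> is \<open>sin x / x\<close>.\<close>

definition nsinc :: "real \<Rightarrow> real" where
  "nsinc x = (if x = 0 then 1 else sin (pi * x) / (pi * x))"

text \<open>Standard deviation \<open>0\<close> is allowed and gives a point mass, so that Gaussian vectors with
  singular covariance matrix are included below.\<close>

definition gaussian_measure :: "real \<Rightarrow> real \<Rightarrow> real measure" where
  "gaussian_measure \<mu> s =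
     (if s = 0 then return borel \<mu> else density lborel (\<lambda>x. ennreal (normal_density \<mu> s x)))"

definition gaussian_rv :: "'a measure \<Rightarrow> ('a \<Rightarrow> real) \<Rightarrow> bool" where
  "gaussian_rv M X \<longleftrightarrow>
     X \<in> borel_measurable M \<and> (\<exists>\<mu> s. 0 \<le> s \<and> distr M borel X = gaussian_measure \<mu> s)"

definition jointly_gaussian :: "'a measure \<Rightarrow> 'i set \<Rightarrow> ('i \<Rightarrow> 'a \<Rightarrow> real) \<Rightarrow> bool" where
  "jointly_gaussian M I X \<longleftrightarrow> (\<forall>a :: 'i \<Rightarrow> real. gaussian_rv M (\<lambda>\<omega>. \<Sum>i\<in>I. a i * X i \<omega>))"

text \<open>Intended for square matrices only: for a matrix with more columns than rows, the eigenvalues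
  of \<open>A\<^sup>T * A\<close> include extra zeros.\<close>

definition singular_values :: "real mat \<Rightarrow> real set" where
  "singular_values A = {sqrt l | l. eigenvalue (transpose_mat A * A) l}"

definition sigma_min :: "real mat \<Rightarrow> real" where
  "sigma_min A = Min (singular_values A)"

text \<open>Rows and columns are numbered \<open>0, \<dots>, 2 * N\<close> by the matrix library; row \<open>i\<close> and column \<open>j\<close>
  carry the indices \<open>m = i - N\<close> and \<open>n = j - N\<close> in \<open>{-N..N}\<close>.\<close>

definition sinc_matrix :: "nat \<Rightarrow> (int \<Rightarrow> real) \<Rightarrow> real mat" where
  "sinc_matrix N x = Matrix.mat (2 * N + 1) (2 * N + 1)
     (\<lambda>(i, j). let m = int i - int N; n = int j - int N in nsinc (of_int (m - n) + x m))"

end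

theory Submission
  imports Defs "Jordan_Normal_Form.Spectral_Radius"
begin

text \<open>
  If all \<open>\<bar>\<xi> m\<bar>\<close> are at most \<open>c\<close>, the matrix differs from the identity by an operator of norm at most
  \<open>exp (pi * c) - 1 = 1 - \<epsilon>\<close> (the argument of Duffin and Eachus), so its smallest singular value is at
  least \<open>\<epsilon>\<close>. By Sidak's inequality the probability of this event is at least the product of the
  \<open>2 * N + 1\<close> marginal probabilities, whatever the correlations, and each of these is at least \<open>1 - q\<close>
  by a tail estimate of Mills type.

  Sidak's inequality splits off one coordinate \<open>X j\<close> at a time: the remaining coordinates are
  \<open>r i * X j + W i\<close> with \<open>W\<close> independent of \<open>X j\<close>, and the conditional probability of the remaining
  slabs given \<open>X j = t\<close> is an even log-concave function of \<open>t\<close>, hence decreasing in \<open>\<bar>t\<bar>\<close> and positively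
  correlated with the indicator of \<open>\<bar>X j\<bar> \<le> c\<close>. Log-concavity is the one-dimensional
  Prekopa--Leindler inequality. Independence of the residuals is read off the characteristic function
  through the Cramer--Wold theorem.
\<close>

section \<open>The Prekopa--Leindler inequality on the line\<close>

text \<open>The hypothesis on \<open>N\<close> says that \<open>(1 - q) ^ (2 * N + 1)\<close> is at
  least \<open>1 - \<eta>\<close>. A union bound over the coordinates would give only the smaller
  value \<open>1 - (2 * N + 1) * q\<close>, hence the need for a product bound without independence.

  The covariance matrix may be singular, so there is no joint density to which a multidimensional
  Prekopa--Leindler inequality could be applied. Conditioning on one coordinate at a time needs only
  the law of that coordinate, a normal density or a point mass; joint laws are handled through
  characteristic functions.

  The number \<open>exp (pi * c) - 1\<close> is the sum of \<open>(pi * c) ^ k / fact k\<close> over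
  \<open>k \<ge> 1\<close>: the matrix entries are Fourier integrals over \<open>{-pi..pi}\<close>,
  the term of order \<open>k\<close> in \<open>x m * t\<close> is controlled by
  \<open>\<bar>x m\<bar> \<le> c\<close> and \<open>\<bar>t\<bar> \<le> pi\<close>, and the term of
  order 0 is the identity matrix. The constant \<open>c\<close> solves
  \<open>exp (pi * c) = 2 - \<epsilon>\<close>.

  The event in the conclusion must itself be shown measurable, although \<open>sigma_min\<close> is
  given by eigenvalues and not by a formula.\<close>

lemma emeasure_lborel_translate:
  fixes A :: "real set"
  assumes "A \<in> sets borel"
  shows "(\<lambda>x. b + x) ` A \<in> sets borel" "emeasure lborel ((\<lambda>x. b + x) ` A) = emeasure lborel A"
proof -
  have eq: "(\<lambda>x. b + x) ` A = (\<lambda>x. x - b) -` A \<inter> space borel"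
    by (auto simp: image_iff) (metis add.commute diff_add_cancel)
  show "(\<lambda>x. b + x) ` A \<in> sets borel"
    unfolding eq by (rule measurable_sets[OF _ assms]) simp
  have "emeasure lborel A = emeasure (distr lborel borel (\<lambda>x. (-b) + x)) A"
    by (simp only: lborel_distr_plus)
  also have "\<dots> = emeasure lborel ((\<lambda>x. b + x) ` A)"
    using assms by (simp add: emeasure_distr eq)
  finally show "emeasure lborel ((\<lambda>x. b + x) ` A) = emeasure lborel A" by simp
qed

text \<open>For \<open>a \<in> A\<close> close to \<open>Sup A\<close> and \<open>b \<in> B\<close>
  close to \<open>Inf B\<close>, the translates \<open>b + A\<close> and \<open>a + B\<close> both
  lie in \<open>C\<close> and overlap at most in an interval of length \<open>e\<close>. Stating the
  bound for any Borel superset \<open>C\<close> avoids the Minkowski sum itself, which need not be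
  Borel.\<close>

lemma brunn_minkowski_real:
  fixes A B C :: "real set"
  assumes A: "A \<in> sets borel" "A \<noteq> {}" "bounded A"
    and B: "B \<in> sets borel" "B \<noteq> {}" "bounded B"
    and C: "C \<in> sets borel" and sub: "\<And>a b. a \<in> A \<Longrightarrow> b \<in> B \<Longrightarrow> a + b \<in> C"
  shows "emeasure lborel A + emeasure lborel B \<le> emeasure lborel C"
proof (rule ennreal_le_epsilon)
  fix e :: real assume e: "0 < e"
  have bA: "bdd_above A" and bB: "bdd_below B"
    using A B bounded_imp_bdd_above bounded_imp_bdd_below by auto
  obtain a where a: "a \<in> A" "Sup A - e/2 < a"
    using less_cSup_iff[OF A(2) bA, of "Sup A - e/2"] e by auto
  obtain b where b: "b \<in> B" "b < Inf B + e/2"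
    using cInf_less_iff[OF B(2) bB, of "Inf B + e/2"] e by auto
  let ?A = "(\<lambda>x. b + x) ` A" and ?B = "(\<lambda>x. a + x) ` B"
  have m: "?A \<in> sets lborel" "?B \<in> sets lborel"
    using emeasure_lborel_translate[OF A(1)] emeasure_lborel_translate[OF B(1)] by auto
  have "?A \<inter> ?B \<subseteq> {a + Inf B .. b + Sup A}"
  proof
    fix z assume "z \<in> ?A \<inter> ?B"
    then obtain x y where "x \<in> A" "y \<in> B" "z = b + x" "z = a + y" by auto
    then show "z \<in> {a + Inf B .. b + Sup A}"
      using cSup_upper[OF _ bA, of x] cInf_lower[OF _ bB, of y] by auto
  qed
  then have "emeasure lborel (?A \<inter> ?B) \<le> emeasure lborel {a + Inf B .. b + Sup A}"
    by (intro emeasure_mono) auto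
  also have "\<dots> \<le> ennreal e"
    using a b by (auto simp: emeasure_lborel_Icc_eq intro!: ennreal_leI)
  finally have int: "emeasure lborel (?A \<inter> ?B) \<le> ennreal e" .
  have "emeasure lborel A + emeasure lborel B = emeasure lborel ?A + emeasure lborel ?B"
    using emeasure_lborel_translate[OF A(1)] emeasure_lborel_translate[OF B(1)] by simp
  also have "\<dots> = emeasure lborel (?A \<union> ?B) + emeasure lborel (?A \<inter> ?B)"
    by (rule emeasure_Un_Int[OF m])
  also have "\<dots> \<le> emeasure lborel C + ennreal e"
  proof (rule add_mono[OF _ int])
    show "emeasure lborel (?A \<union> ?B) \<le> emeasure lborel C"
    proof (rule emeasure_mono)
      show "?A \<union> ?B \<subseteq> C" using sub[OF _ b(1)] sub[OF a(1)] by (auto simp: add.commute)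
    qed (use C in simp)
  qed
  finally show "emeasure lborel A + emeasure lborel B \<le> emeasure lborel C + ennreal e" .
qed

lemma emeasure_lborel_scale:
  fixes A :: "real set"
  assumes "A \<in> sets borel" "0 < r"
  shows "(\<lambda>x. r * x) ` A \<in> sets borel" "emeasure lborel ((\<lambda>x. r * x) ` A) = ennreal r * emeasure lborel A"
proof -
  have eq: "(\<lambda>x. r * x) ` A = (\<lambda>x. x / r) -` A \<inter> space borel"
  proof -
    have "x \<in> (\<lambda>x. r * x) ` A" if "x / r \<in> A" for x
      using that assms(2) by (intro image_eqI[of _ _ "x / r"]) auto
    then show ?thesis using assms(2) by auto
  qed
  show m: "(\<lambda>x. r * x) ` A \<in> sets borel"
    unfolding eq by (rule measurable_sets[OF _ assms(1)]) simp
  have lb: "lborel = density (distr lborel borel (\<lambda>x. r * x)) (\<lambda>_. ennreal r)"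
    using lborel_affine[of r "0::real"] assms by (simp add: scaleR_conv_of_real[abs_def])
  have "(*) r -` (*) r ` A = A" using assms(2) by auto
  then have "emeasure (density (distr lborel borel (\<lambda>x. r * x)) (\<lambda>_. ennreal r)) ((\<lambda>x. r * x) ` A)
      = ennreal r * emeasure lborel A"
    using assms m by (subst emeasure_density_const) (auto simp: emeasure_distr)
  then show "emeasure lborel ((\<lambda>x. r * x) ` A) = ennreal r * emeasure lborel A"
    by (simp flip: lb)
qed

text \<open>Fubini's theorem on the region under the graph. Since \<open>f \<le> 1\<close>,
  restricting the heights to the open unit interval loses nothing.\<close>

lemma layer_cake_unit:
  fixes f :: "real \<Rightarrow> real"
  assumes [measurable]: "f \<in> borel_measurable borel"
    and "\<And>x. 0 \<le> f x" "\<And>x. f x \<le> 1"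
  shows "(\<integral>\<^sup>+x. ennreal (f x) \<partial>lborel) = (\<integral>\<^sup>+t. indicator {0<..<1} t * emeasure lborel {x. t < f x} \<partial>lborel)"
proof -
  have "(\<integral>\<^sup>+x. ennreal (f x) \<partial>lborel) = (\<integral>\<^sup>+x. \<integral>\<^sup>+t. indicator {0<..<1} t * indicator {x. t < f x} x \<partial>lborel \<partial>lborel)"
  proof (rule nn_integral_cong)
    fix x
    have "(\<integral>\<^sup>+t. indicator {0<..<1} t * indicator {x. t < f x} x \<partial>lborel) = (\<integral>\<^sup>+t. indicator {0<..<f x} t \<partial>lborel)"
      using assms(3)[of x] by (intro nn_integral_cong) (auto simp: indicator_def)
    also have "\<dots> = ennreal (f x)" using assms(2)[of x] by simp
    finally show "ennreal (f x) = (\<integral>\<^sup>+t. indicator {0<..<1} t * indicator {x. t < f x} x \<partial>lborel)" by simp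
  qed
  also have "\<dots> = (\<integral>\<^sup>+t. \<integral>\<^sup>+x. indicator {0<..<1} t * indicator {x. t < f x} x \<partial>lborel \<partial>lborel)"
    by (rule lborel_pair.Fubini') simp
  also have "\<dots> = (\<integral>\<^sup>+t. indicator {0<..<1} t * emeasure lborel {x. t < f x} \<partial>lborel)"
    by (intro nn_integral_cong) (simp add: nn_integral_cmult)
  finally show ?thesis .
qed

lemma weighted_geo_mean_le_arith:
  fixes x y :: real
  assumes "0 \<le> x" "0 \<le> y" "0 < l" "l < 1"
  shows "x powr (1 - l) * y powr l \<le> (1 - l) * x + l * y"
  using Youngs_inequality_0[of "1 - l" l x y] assms
  by (cases "x = 0 \<or> y = 0") auto

text \<open>Both functions are normalised to have supremum 1, so that the superlevel sets at every height
  in \<open>(0, 1)\<close> are nonempty and the Brunn--Minkowski inequality applies to them.\<close>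

lemma prekopa_leindler_normalized:
  fixes f g h :: "real \<Rightarrow> real"
  assumes [measurable]: "f \<in> borel_measurable borel" "g \<in> borel_measurable borel" "h \<in> borel_measurable borel"
    and f: "\<And>x. 0 \<le> f x" "\<And>x. f x \<le> 1" "\<And>t. t < 1 \<Longrightarrow> \<exists>x. t < f x" "bounded {x. f x \<noteq> 0}"
    and g: "\<And>x. 0 \<le> g x" "\<And>x. g x \<le> 1" "\<And>t. t < 1 \<Longrightarrow> \<exists>x. t < g x" "bounded {x. g x \<noteq> 0}"
    and h: "\<And>x. 0 \<le> h x"
    and l: "0 < l" "l < 1"
    and le: "\<And>x y. f x powr (1 - l) * g y powr l \<le> h ((1 - l) * x + l * y)"
  shows "ennreal (1 - l) * (\<integral>\<^sup>+x. ennreal (f x) \<partial>lborel) + ennreal l * (\<integral>\<^sup>+x. ennreal (g x) \<partial>lborel)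
     \<le> (\<integral>\<^sup>+x. ennreal (h x) \<partial>lborel)"
proof -
  \<comment> \<open>The supremum of \<open>h\<close> may exceed 1. Truncation makes the layer cake
    formula on the unit interval applicable and leaves the superlevel sets at heights below 1
    unchanged.\<close>
  define h' where "h' x = min 1 (h x)" for x
  have [measurable]: "h' \<in> borel_measurable borel" unfolding h'_def by measurable
  have level: "ennreal (1 - l) * emeasure lborel {x. t < f x} + ennreal l * emeasure lborel {x. t < g x}
     \<le> emeasure lborel {x. t < h' x}" if t: "0 < t" "t < 1" for t
  proof -
    have mA: "{x. t < f x} \<in> sets borel" "{x. t < g x} \<in> sets borel" "{x. t < h' x} \<in> sets borel" by measurable
    have bA: "bounded {x. t < f x}" by (rule bounded_subset[OF f(4)]) (use t in auto)
    have bB: "bounded {x. t < g x}" by (rule bounded_subset[OF g(4)]) (use t in auto)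
    have "emeasure lborel ((\<lambda>x. (1-l) * x) ` {x. t < f x}) + emeasure lborel ((\<lambda>x. l * x) ` {x. t < g x}) \<le> emeasure lborel {x. t < h' x}"
    proof (rule brunn_minkowski_real)
      fix a b assume "a \<in> (*) (1-l) ` {x. t < f x}" "b \<in> (*) l ` {x. t < g x}"
      then obtain x y where xy: "t < f x" "t < g y" "a = (1-l)*x" "b = l * y" by auto
      have "t = t powr (1-l) * t powr l" using t by (simp flip: powr_add)
      also have "\<dots> < f x powr (1-l) * g y powr l"
        using xy t l by (intro mult_strict_mono powr_less_mono2) auto
      also have "\<dots> \<le> h (a + b)" using le xy by simp
      finally show "a + b \<in> {x. t < h' x}" using t by (simp add: h'_def)
    qed (use emeasure_lborel_scale[OF mA(1), of "1-l"] emeasure_lborel_scale[OF mA(2), of l] l mA t f(3)[of t] g(3)[of t]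
          bounded_scaling[OF bA, of "1-l"] bounded_scaling[OF bB, of l] in auto)
    then show ?thesis using emeasure_lborel_scale[OF mA(1), of "1-l"] emeasure_lborel_scale[OF mA(2), of l] l by simp
  qed
  have [measurable]: "(\<lambda>t. emeasure lborel {x. t < k x}) \<in> borel_measurable borel"
    if [measurable]: "k \<in> borel_measurable borel" for k :: "real \<Rightarrow> real"
  proof -
    have "(\<lambda>t. \<integral>\<^sup>+x. indicator {p. fst p < k (snd p)} (t, x) \<partial>lborel) \<in> borel_measurable borel"
      by measurable
    moreover have "(\<integral>\<^sup>+x. indicator {p. fst p < k (snd p)} (t, x) \<partial>lborel) = emeasure lborel {x. t < k x}" for t
    proof -
      have "(\<integral>\<^sup>+x. indicator {p. fst p < k (snd p)} (t, x) \<partial>lborel) = (\<integral>\<^sup>+x. indicator {x. t < k x} x \<partial>lborel)"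
        by (intro nn_integral_cong) (auto simp: indicator_def)
      then show ?thesis by simp
    qed
    ultimately show ?thesis by simp
  qed
  have "ennreal (1 - l) * (\<integral>\<^sup>+x. ennreal (f x) \<partial>lborel) + ennreal l * (\<integral>\<^sup>+x. ennreal (g x) \<partial>lborel)
     = (\<integral>\<^sup>+t. indicator {0<..<1} t * (ennreal (1 - l) * emeasure lborel {x. t < f x} + ennreal l * emeasure lborel {x. t < g x}) \<partial>lborel)"
    unfolding layer_cake_unit[OF assms(1) f(1,2)] layer_cake_unit[OF assms(2) g(1,2)]
    by (simp add: nn_integral_add nn_integral_cmult distrib_left mult.left_commute)
  also have "\<dots> \<le> (\<integral>\<^sup>+t. indicator {0<..<1} t * emeasure lborel {x. t < h' x} \<partial>lborel)"
    using level by (intro nn_integral_mono) (auto simp: indicator_def)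
  also have "\<dots> = (\<integral>\<^sup>+x. ennreal (h' x) \<partial>lborel)"
    by (rule layer_cake_unit[symmetric]) (auto simp: h'_def h)
  also have "\<dots> \<le> (\<integral>\<^sup>+x. ennreal (h x) \<partial>lborel)"
    by (intro nn_integral_mono ennreal_leI) (auto simp: h'_def)
  finally show ?thesis .
qed

text \<open>Dividing \<open>f\<close>, \<open>g\<close> and \<open>h\<close> by \<open>S\<close>,
  \<open>T\<close> and \<open>R = S powr (1 - l) * T powr l\<close> preserves the pointwise
  hypothesis and makes both suprema equal to 1. The normalised inequality bounds an arithmetic mean,
  which dominates the geometric mean, and in the geometric mean the factors cancel against
  \<open>R\<close>. Boundedness and bounded support make \<open>f\<close> and \<open>g\<close>
  integrable; in the application they come from the normal density and from the slab.\<close>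

theorem prekopa_leindler_real:
  fixes f g h :: "real \<Rightarrow> real"
  assumes [measurable]: "f \<in> borel_measurable borel" "g \<in> borel_measurable borel" "h \<in> borel_measurable borel"
    and f: "\<And>x. 0 \<le> f x" "bdd_above (range f)" "bounded {x. f x \<noteq> 0}"
    and g: "\<And>x. 0 \<le> g x" "bdd_above (range g)" "bounded {x. g x \<noteq> 0}"
    and h: "\<And>x. 0 \<le> h x" "integrable lborel h"
    and l: "0 < l" "l < 1"
    and le: "\<And>x y. f x powr (1 - l) * g y powr l \<le> h ((1 - l) * x + l * y)"
  shows "(LINT x|lborel. f x) powr (1 - l) * (LINT x|lborel. g x) powr l \<le> (LINT x|lborel. h x)"
proof (cases "(\<forall>x. f x = 0) \<or> (\<forall>x. g x = 0)")
  case True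
  then show ?thesis using h by (auto intro!: integral_nonneg_AE)
next
  case False
  define S where "S = Sup (range f)"
  define T where "T = Sup (range g)"
  have fS: "f x \<le> S" for x unfolding S_def by (rule cSup_upper[OF _ f(2)]) simp
  have gT: "g x \<le> T" for x unfolding T_def by (rule cSup_upper[OF _ g(2)]) simp
  from False obtain x0 y0 where "f x0 \<noteq> 0" "g y0 \<noteq> 0" by auto
  then have S0: "0 < S" and T0: "0 < T"
    using f(1)[of x0] fS[of x0] g(1)[of y0] gT[of y0] by linarith+
  define R where "R = S powr (1 - l) * T powr l"
  have R0: "0 < R" unfolding R_def using S0 T0 by simp
  have int_bs: "integrable lborel k" if [measurable]: "k \<in> borel_measurable borel" and bd: "bounded {x. k x \<noteq> 0}"
    and k: "\<And>x. 0 \<le> k x" "\<And>x. k x \<le> B" for k :: "real \<Rightarrow> real" and B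
  proof -
    obtain a where "\<And>x. k x \<noteq> 0 \<Longrightarrow> \<bar>x\<bar> \<le> a"
      using bd unfolding bounded_iff by auto
    then have a: "{x. k x \<noteq> 0} \<subseteq> {-a..a}" by (force simp: abs_le_iff)
    show ?thesis
    proof (rule integrableI_bounded_set[where A="{-a..a}" and B=B])
      show "AE x in lborel. x \<in> {-a..a} \<longrightarrow> norm (k x) \<le> B" using k by auto
      show "AE x in lborel. x \<notin> {-a..a} \<longrightarrow> k x = 0" using a by (intro AE_I2) auto
      show "emeasure lborel {-a..a} < \<infinity>" by (simp add: emeasure_lborel_Icc_eq)
    qed auto
  qed
  have fi: "integrable lborel f" by (rule int_bs[OF _ f(3) f(1) fS]) simp
  have gi: "integrable lborel g" by (rule int_bs[OF _ g(3) g(1) gT]) simp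
  let ?F = "LINT x|lborel. f x" and ?G = "LINT x|lborel. g x" and ?H = "LINT x|lborel. h x"
  have F0: "0 \<le> ?F" and G0: "0 \<le> ?G" and H0: "0 \<le> ?H"
    using f g h by (auto intro!: integral_nonneg_AE)
  have nnf: "(\<integral>\<^sup>+x. ennreal (f x / S) \<partial>lborel) = ennreal (?F / S)"
    using fi f(1) S0 by (subst nn_integral_eq_integral) auto
  have nng: "(\<integral>\<^sup>+x. ennreal (g x / T) \<partial>lborel) = ennreal (?G / T)"
    using gi g(1) T0 by (subst nn_integral_eq_integral) auto
  have nnh: "(\<integral>\<^sup>+x. ennreal (h x / R) \<partial>lborel) = ennreal (?H / R)"
    using h R0 by (subst nn_integral_eq_integral) auto
  have "ennreal (1 - l) * ennreal (?F / S) + ennreal l * ennreal (?G / T) \<le> ennreal (?H / R)"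
    unfolding nnf[symmetric] nng[symmetric] nnh[symmetric]
  proof (rule prekopa_leindler_normalized)
    fix t :: real assume "t < 1"
    then have "t * S < S" "t * T < T" using S0 T0 by auto
    then show "\<exists>x. t < f x / S" "\<exists>x. t < g x / T"
      using less_cSup_iff[of "range f" "t * S"] less_cSup_iff[of "range g" "t * T"] f(2) g(2) S0 T0
      by (auto simp: S_def T_def field_simps)
  next
    fix x y
    have "(f x / S) powr (1 - l) * (g y / T) powr l = f x powr (1 - l) * g y powr l / R"
      using S0 T0 f(1)[of x] g(1)[of y] by (simp add: powr_divide R_def)
    also have "\<dots> \<le> h ((1-l) * x + l * y) / R" using le R0 by (intro divide_right_mono) auto
    finally show "(f x / S) powr (1 - l) * (g y / T) powr l \<le> h ((1-l) * x + l * y) / R" .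
  qed (use f g h l S0 T0 R0 fS gT in auto)
  then have "ennreal ((1 - l) * (?F / S) + l * (?G / T)) \<le> ennreal (?H / R)"
    using l F0 G0 S0 T0 ennreal_mult[of "1 - l" "?F / S"] ennreal_mult[of l "?G / T"]
      ennreal_plus[of "(1 - l) * (?F / S)" "l * (?G / T)"] by simp
  then have *: "(1 - l) * (?F / S) + l * (?G / T) \<le> ?H / R"
    using H0 R0 by (subst (asm) ennreal_le_iff) auto
  have "(?F / S) powr (1 - l) * (?G / T) powr l \<le> ?H / R"
    using * weighted_geo_mean_le_arith[of "?F / S" "?G / T" l] l F0 G0 S0 T0 by auto
  moreover have "(?F / S) powr (1 - l) * (?G / T) powr l = ?F powr (1-l) * ?G powr l / R"
    using S0 T0 F0 G0 by (simp add: powr_divide R_def)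
  ultimately show ?thesis using R0 by (simp add: field_simps)
qed

section \<open>The Cramer--Wold theorem\<close>

text \<open>Uniqueness of characteristic functions is available for probability laws only, so a
  bounded weight of positive mass \<open>m\<close> is normalised into one. The real and imaginary
  parts of its characteristic function are the weighted cosine and sine integrals.\<close>

lemma (in prob_space) weighted_distr:
  fixes X w :: "'a \<Rightarrow> real"
  assumes [measurable]: "X \<in> borel_measurable M" "w \<in> borel_measurable M"
    and w: "\<And>x. 0 \<le> w x" "\<And>x. w x \<le> K" and m: "m = (LINT x|M. w x)" "0 < m"
  defines "D \<equiv> distr (density M (\<lambda>x. ennreal (w x / m))) borel X"
  shows "real_distribution D"
    and "char D t = Complex ((LINT x|M. cos (t * X x) * w x) / m) ((LINT x|M. sin (t * X x) * w x) / m)"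
    and "B \<in> sets borel \<Longrightarrow> (LINT x|M. indicator B (X x) * w x) = m * measure D B"
proof -
  have wi: "integrable M w" using w by (intro integrable_const_bound[of _ K]) auto
  have "prob_space (density M (\<lambda>x. ennreal (w x / m)))"
    by (intro prob_spaceI)
      (use wi w m in \<open>simp add: emeasure_density nn_integral_eq_integral\<close>)
  then show D: "real_distribution D" unfolding D_def by (rule prob_space.real_distribution_distr) simp
  have i: "integrable M (\<lambda>x. (w x / m) *\<^sub>R iexp (t * X x))"
    using w m(2) by (intro integrable_const_bound[of _ "K / m"]) (auto simp: divide_right_mono)
  have ch: "char D t = (CLINT x|M. (w x / m) *\<^sub>R iexp (t * X x))"
    unfolding char_def D_def using w m(2) by (simp add: integral_distr integral_density)
  have "Re (char D t) = (LINT x|M. cos (t * X x) * w x) / m"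
    unfolding ch integral_Re[OF i, symmetric] by (simp add: Re_exp mult.commute)
  moreover have "Im (char D t) = (LINT x|M. sin (t * X x) * w x) / m"
    unfolding ch integral_Im[OF i, symmetric] by (simp add: Im_exp mult.commute)
  ultimately show "char D t = Complex ((LINT x|M. cos (t * X x) * w x) / m) ((LINT x|M. sin (t * X x) * w x) / m)"
    by (simp add: complex_eq_iff)
  show "(LINT x|M. indicator B (X x) * w x) = m * measure D B" if [measurable]: "B \<in> sets borel"
  proof -
    interpret D: real_distribution D by (rule D)
    have "measure D B = (LINT y|D. indicator B y)" by simp
    also have "\<dots> = (LINT x|density M (\<lambda>x. ennreal (w x / m)). indicator B (X x))"
      unfolding D_def by (rule integral_distr) auto
    also have "\<dots> = (LINT x|M. (w x / m) * indicator B (X x))"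
      using w m(2) by (subst integral_density) auto
    finally show ?thesis using m(2) by (simp add: mult.commute)
  qed
qed

text \<open>The phase \<open>\<beta>\<close> encodes both parts of the characteristic function: 0
  gives the cosine and \<open>- pi / 2\<close> the sine. Equality of the total masses is the case
  \<open>t = 0\<close>, \<open>\<beta> = 0\<close>. A weight of mass 0 cannot be normalised, but
  then it vanishes almost everywhere.\<close>

lemma weighted_law_unique:
  fixes X w :: "'a \<Rightarrow> real" and Y v :: "'b \<Rightarrow> real"
  assumes M: "prob_space M" and N: "prob_space N"
    and [measurable]: "X \<in> borel_measurable M" "w \<in> borel_measurable M"
      "Y \<in> borel_measurable N" "v \<in> borel_measurable N"
    and w: "\<And>x. 0 \<le> w x" "\<And>x. w x \<le> K" and v: "\<And>x. 0 \<le> v x" "\<And>x. v x \<le> K"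
    and eq: "\<And>t \<beta>. (LINT x|M. cos (t * X x + \<beta>) * w x) = (LINT x|N. cos (t * Y x + \<beta>) * v x)"
    and B [measurable]: "B \<in> sets borel"
  shows "(LINT x|M. indicator B (X x) * w x) = (LINT x|N. indicator B (Y x) * v x)"
proof -
  interpret M: prob_space M by fact
  interpret N: prob_space N by fact
  define m where "m = (LINT x|M. w x)"
  have mv: "m = (LINT x|N. v x)"
    unfolding m_def using eq[of 0 0] by simp
  have wi: "integrable M w" using w by (intro M.integrable_const_bound[of _ K]) auto
  have vi: "integrable N v" using v by (intro N.integrable_const_bound[of _ K]) auto
  show ?thesis
  proof (cases "m = 0")
    case True
    have "AE x in M. w x = 0"
      using integral_nonneg_eq_0_iff_AE[OF wi] w True by (simp add: m_def)
    then have 1: "(LINT x|M. indicator B (X x) * w x) = 0"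
      by (intro integral_eq_zero_AE) auto
    have "AE x in N. v x = 0"
      using integral_nonneg_eq_0_iff_AE[OF vi] v True by (simp add: mv)
    then have "(LINT x|N. indicator B (Y x) * v x) = 0"
      by (intro integral_eq_zero_AE) auto
    then show ?thesis using 1 by simp
  next
    case False
    have "0 \<le> m" unfolding m_def using w by simp
    then have m: "0 < m" using False by simp
    note D = M.weighted_distr[OF assms(3,4) w m_def m]
    note E = N.weighted_distr[OF assms(5,6) v mv m]
    have "(LINT x|M. sin (t * X x) * w x) = (LINT x|N. sin (t * Y x) * v x)" for t
      using eq[of t "- pi / 2"] by (simp add: cos_diff)
    moreover have "(LINT x|M. cos (t * X x) * w x) = (LINT x|N. cos (t * Y x) * v x)" for t
      using eq[of t 0] by simp
    ultimately show ?thesis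
      using Levy_uniqueness[OF D(1) E(1)] by (simp add: D(2,3) E(2,3) fun_eq_iff)
  qed
qed

text \<open>The weight \<open>1 + cos\<close> is nonnegative, which makes the uniqueness theorem for probability
  distributions on the line applicable one coordinate at a time.\<close>

lemma rectangle_cos_integral_eq:
  fixes X :: "'i \<Rightarrow> 'a \<Rightarrow> real" and Y :: "'i \<Rightarrow> 'b \<Rightarrow> real"
  assumes M: "prob_space M" and N: "prob_space N" and I: "finite I"
    and X: "\<And>i. i \<in> I \<Longrightarrow> X i \<in> borel_measurable M"
    and Y: "\<And>i. i \<in> I \<Longrightarrow> Y i \<in> borel_measurable N"
    and eq: "\<And>a. (CLINT x|M. iexp (\<Sum>i\<in>I. a i * X i x)) = (CLINT x|N. iexp (\<Sum>i\<in>I. a i * Y i x))"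
    and J: "finite J" "J \<subseteq> I" and B: "\<And>i. i \<in> J \<Longrightarrow> B i \<in> sets borel"
  shows "(LINT x|M. (\<Prod>i\<in>J. indicator (B i) (X i x)) * cos ((\<Sum>i\<in>I. a i * X i x) + \<alpha>)) =
         (LINT x|N. (\<Prod>i\<in>J. indicator (B i) (Y i x)) * cos ((\<Sum>i\<in>I. a i * Y i x) + \<alpha>))"
  using J B
proof (induction J arbitrary: a \<alpha> rule: finite_induct)
  case empty
  have cosE: "(LINT x|P. cos (S x + \<alpha>)) = Re ((CLINT x|P. iexp (S x)) * cis \<alpha>)"
    if "prob_space P" "S \<in> borel_measurable P" for P :: "'c measure" and S
  proof -
    interpret P: prob_space P by fact
    have [measurable]: "S \<in> borel_measurable P" by fact
    have i: "integrable P (\<lambda>x. iexp (S x))" by (rule P.integrable_iexp) auto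
    have "Re ((CLINT x|P. iexp (S x)) * cis \<alpha>) = Re (CLINT x|P. iexp (S x) * cis \<alpha>)"
      using i by simp
    also have "\<dots> = (LINT x|P. Re (iexp (S x) * cis \<alpha>))"
      using i by (intro integral_Re[symmetric] integrable_mult_left) auto
    also have "\<dots> = (LINT x|P. cos (S x + \<alpha>))"
      by (intro Bochner_Integration.integral_cong) (auto simp: Re_exp Im_exp cos_add)
    finally show ?thesis by simp
  qed
  show ?case
    using cosE[OF M, of "\<lambda>x. \<Sum>i\<in>I. a i * X i x"] cosE[OF N, of "\<lambda>x. \<Sum>i\<in>I. a i * Y i x"] X Y eq by simp
next
  case (insert j J)
  interpret M: prob_space M by fact
  interpret N: prob_space N by fact
  let ?P = "\<lambda>x. \<Prod>i\<in>J. indicator (B i) (X i x) :: real"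
  let ?Q = "\<lambda>x. \<Prod>i\<in>J. indicator (B i) (Y i x) :: real"
  let ?S = "\<lambda>a x. \<Sum>i\<in>I. a i * X i x" and ?T = "\<lambda>a x. \<Sum>i\<in>I. a i * Y i x"
  have jI: "j \<in> I" and JI: "J \<subseteq> I" using insert.prems by auto
  have [measurable]: "X j \<in> borel_measurable M" "Y j \<in> borel_measurable N" "B j \<in> sets borel"
    using X Y jI insert.prems by auto
  have [measurable]: "?P \<in> borel_measurable M" "?Q \<in> borel_measurable N"
    using X Y JI insert.prems
    by (auto intro!: borel_measurable_prod measurable_compose[OF _ borel_measurable_indicator])
  have [measurable]: "?S a \<in> borel_measurable M" "?T a \<in> borel_measurable N" for a
    using X Y by auto
  have IH: "(LINT x|M. ?P x * cos (?S a x + \<alpha>)) = (LINT x|N. ?Q x * cos (?T a x + \<alpha>))" for a \<alpha>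
    using insert JI by blast
  have P: "0 \<le> ?P x" "?P x \<le> 1" for x by (auto intro!: prod_nonneg prod_le_1 simp: indicator_def)
  have Q: "0 \<le> ?Q x" "?Q x \<le> 1" for x by (auto intro!: prod_nonneg prod_le_1 simp: indicator_def)
  have iM: "integrable M (\<lambda>x. ?P x * u x)" if [measurable]: "u \<in> borel_measurable M" and "\<And>x. \<bar>u x\<bar> \<le> 1" for u
    using P that(2) by (intro M.integrable_const_bound[of _ 1]) (auto simp: abs_mult intro!: mult_le_one)
  have iN: "integrable N (\<lambda>x. ?Q x * u x)" if [measurable]: "u \<in> borel_measurable N" and "\<And>x. \<bar>u x\<bar> \<le> 1" for u
    using Q that(2) by (intro N.integrable_const_bound[of _ 1]) (auto simp: abs_mult intro!: mult_le_one)
  have key: "(LINT x|M. indicator (B j) (X j x) * (?P x * (1 + cos (?S a x + \<alpha>)))) =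
      (LINT x|N. indicator (B j) (Y j x) * (?Q x * (1 + cos (?T a x + \<alpha>))))" for a \<alpha>
  proof (rule weighted_law_unique[OF M N, where K = 2])
    fix x
    have "0 \<le> 1 + cos (?S a x + \<alpha>)" "1 + cos (?S a x + \<alpha>) \<le> 2" using cos_ge_minus_one[of "?S a x + \<alpha>"] cos_le_one[of "?S a x + \<alpha>"] by linarith+
    then show "0 \<le> ?P x * (1 + cos (?S a x + \<alpha>))" "?P x * (1 + cos (?S a x + \<alpha>)) \<le> 2"
      using P[of x] mult_mono[of "?P x" 1 "1 + cos (?S a x + \<alpha>)" 2] by auto
  next
    fix x
    have "0 \<le> 1 + cos (?T a x + \<alpha>)" "1 + cos (?T a x + \<alpha>) \<le> 2" using cos_ge_minus_one[of "?T a x + \<alpha>"] cos_le_one[of "?T a x + \<alpha>"] by linarith+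
    then show "0 \<le> ?Q x * (1 + cos (?T a x + \<alpha>))" "?Q x * (1 + cos (?T a x + \<alpha>)) \<le> 2"
      using Q[of x] mult_mono[of "?Q x" 1 "1 + cos (?T a x + \<alpha>)" 2] by auto
  next
    fix t \<beta>
    \<comment> \<open>By the product-to-sum formula, \<open>cos (t * X j x + \<beta>)\<close> times
      \<open>1 + cos\<close> of a linear form is a combination of cosines of linear forms, in which
      the coefficient of \<open>X j\<close> is shifted by \<open>t\<close> or \<open>- t\<close>.
      The induction hypothesis covers them because it holds for all coefficients and all
      phases.\<close>
    define e where "e b i = (if i = j then b else 0 :: real)" for b i
    define a1 where "a1 i = a i + e t i" for i
    define a2 where "a2 i = a i + e (- t) i" for i
    have S: "?S (e b) x = b * X j x" "?S a1 x = ?S a x + t * X j x" "?S a2 x = ?S a x - t * X j x" for b x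
      using I jI by (auto simp: e_def a1_def a2_def algebra_simps sum.distrib if_distrib[of "\<lambda>u. u * _"] if_distrib[of "\<lambda>u. _ * u"] sum.delta cong: if_cong)
    have T: "?T (e b) x = b * Y j x" "?T a1 x = ?T a x + t * Y j x" "?T a2 x = ?T a x - t * Y j x" for b x
      using I jI by (auto simp: e_def a1_def a2_def algebra_simps sum.distrib if_distrib[of "\<lambda>u. u * _"] if_distrib[of "\<lambda>u. _ * u"] sum.delta cong: if_cong)
    have trig: "cos (u + \<beta>) * (p * (1 + cos (s + \<alpha>))) =
       p * cos (u + \<beta>) + (p * cos ((s + u) + (\<alpha> + \<beta>)) + p * cos ((s - u) + (\<alpha> - \<beta>))) / 2" for u s p :: real
    proof -
      have "cos ((s + u) + (\<alpha> + \<beta>)) = cos ((s + \<alpha>) + (u + \<beta>))" "cos ((s - u) + (\<alpha> - \<beta>)) = cos ((s + \<alpha>) - (u + \<beta>))"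
        by (simp_all add: algebra_simps)
      then show ?thesis by (simp only: cos_add[of "s + \<alpha>"] cos_diff[of "s + \<alpha>"]) (simp add: algebra_simps)
    qed
    have "(LINT x|M. cos (t * X j x + \<beta>) * (?P x * (1 + cos (?S a x + \<alpha>)))) =
       (LINT x|M. ?P x * cos (?S (e t) x + \<beta>)) + ((LINT x|M. ?P x * cos (?S a1 x + (\<alpha> + \<beta>))) + (LINT x|M. ?P x * cos (?S a2 x + (\<alpha> - \<beta>)))) / 2"
      unfolding trig S by (simp add: iM)
    also have "\<dots> = (LINT x|N. ?Q x * cos (?T (e t) x + \<beta>)) + ((LINT x|N. ?Q x * cos (?T a1 x + (\<alpha> + \<beta>))) + (LINT x|N. ?Q x * cos (?T a2 x + (\<alpha> - \<beta>)))) / 2"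
      unfolding IH ..
    also have "\<dots> = (LINT x|N. cos (t * Y j x + \<beta>) * (?Q x * (1 + cos (?T a x + \<alpha>))))"
      unfolding trig T by (simp add: iN)
    finally show "(LINT x|M. cos (t * X j x + \<beta>) * (?P x * (1 + cos (?S a x + \<alpha>)))) =
      (LINT x|N. cos (t * Y j x + \<beta>) * (?Q x * (1 + cos (?T a x + \<alpha>))))" .
  qed (measurable)
  have iM': "integrable M (\<lambda>x. indicator (B j) (X j x) * (?P x * (1 + cos (?S a x + \<alpha>))))" for a \<alpha>
  proof -
    have "integrable M (\<lambda>x. ?P x * indicator (B j) (X j x) + ?P x * (indicator (B j) (X j x) * cos (?S a x + \<alpha>)))"
      by (intro Bochner_Integration.integrable_add iM) (auto simp: indicator_def)
    then show ?thesis by (simp add: algebra_simps)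
  qed
  have iN': "integrable N (\<lambda>x. indicator (B j) (Y j x) * (?Q x * (1 + cos (?T a x + \<alpha>))))" for a \<alpha>
  proof -
    have "integrable N (\<lambda>x. ?Q x * indicator (B j) (Y j x) + ?Q x * (indicator (B j) (Y j x) * cos (?T a x + \<alpha>)))"
      by (intro Bochner_Integration.integrable_add iN) (auto simp: indicator_def)
    then show ?thesis by (simp add: algebra_simps)
  qed
  \<comment> \<open>With zero coefficients and zero phase the weight \<open>1 + cos\<close> is the
    constant 2, which cancels. Subtracting this equality from \<open>key\<close> removes the 1 that
    was added for nonnegativity.\<close>
  have key0: "(LINT x|M. indicator (B j) (X j x) * ?P x) = (LINT x|N. indicator (B j) (Y j x) * ?Q x)"
    using key[of "\<lambda>_. 0" 0] by (simp flip: mult.assoc)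
  have i0: "integrable M (\<lambda>x. indicator (B j) (X j x) * ?P x)" "integrable N (\<lambda>x. indicator (B j) (Y j x) * ?Q x)"
    using iM[of "\<lambda>x. indicator (B j) (X j x)"] iN[of "\<lambda>x. indicator (B j) (Y j x)"]
    by (simp_all add: mult.commute indicator_def)
  have split: "(\<Prod>i\<in>insert j J. r i) * cos s = r j * ((\<Prod>i\<in>J. r i) * (1 + cos s)) -
     r j * (\<Prod>i\<in>J. r i)" for r :: "'i \<Rightarrow> real" and s
    using insert.hyps by (simp add: algebra_simps)
  show ?case
    unfolding split
    by (simp only: Bochner_Integration.integral_diff[OF iM' i0(1)] Bochner_Integration.integral_diff[OF iN' i0(2)] key key0)
qed

text \<open>With all frequencies zero the cosine is 1, so the preceding lemma equates the masses of
  measurable rectangles, and these determine a finite measure on the product space. The restriction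
  to \<open>I\<close> is there because points of the product space are extensional
  functions.\<close>

theorem cramer_wold:
  fixes X :: "'i \<Rightarrow> 'a \<Rightarrow> real" and Y :: "'i \<Rightarrow> 'b \<Rightarrow> real"
  assumes M: "prob_space M" and N: "prob_space N" and I: "finite I"
    and X: "\<And>i. i \<in> I \<Longrightarrow> X i \<in> borel_measurable M"
    and Y: "\<And>i. i \<in> I \<Longrightarrow> Y i \<in> borel_measurable N"
    and eq: "\<And>a. (CLINT x|M. iexp (\<Sum>i\<in>I. a i * X i x)) = (CLINT x|N. iexp (\<Sum>i\<in>I. a i * Y i x))"
  shows "distr M (\<Pi>\<^sub>M i\<in>I. borel) (\<lambda>x. \<lambda>i\<in>I. X i x) = distr N (\<Pi>\<^sub>M i\<in>I. borel) (\<lambda>x. \<lambda>i\<in>I. Y i x)"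
proof -
  interpret M: prob_space M by fact
  interpret N: prob_space N by fact
  have [measurable]: "(\<lambda>x. \<lambda>i\<in>I. X i x) \<in> M \<rightarrow>\<^sub>M (\<Pi>\<^sub>M i\<in>I. borel)" using X by (intro measurable_restrict) auto
  have [measurable]: "(\<lambda>x. \<lambda>i\<in>I. Y i x) \<in> N \<rightarrow>\<^sub>M (\<Pi>\<^sub>M i\<in>I. borel)" using Y by (intro measurable_restrict) auto
  let ?D = "distr M (\<Pi>\<^sub>M i\<in>I. borel) (\<lambda>x. \<lambda>i\<in>I. X i x)" and ?E = "distr N (\<Pi>\<^sub>M i\<in>I. borel) (\<lambda>x. \<lambda>i\<in>I. Y i x)"
  have rect: "emeasure (distr P (\<Pi>\<^sub>M i\<in>I. borel) (\<lambda>x. \<lambda>i\<in>I. Z i x)) (Pi\<^sub>E I A) =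
      ennreal (LINT x|P. (\<Prod>i\<in>I. indicator (A i) (Z i x)) * cos ((\<Sum>i\<in>I. 0 * Z i x) + 0))"
    if "prob_space P" and Z: "\<And>i. i \<in> I \<Longrightarrow> Z i \<in> borel_measurable P" and A: "\<And>i. i \<in> I \<Longrightarrow> A i \<in> sets borel"
    for P :: "'c measure" and Z and A :: "'i \<Rightarrow> real set"
  proof -
    interpret P: prob_space P by fact
    have [measurable]: "(\<lambda>x. \<lambda>i\<in>I. Z i x) \<in> P \<rightarrow>\<^sub>M (\<Pi>\<^sub>M i\<in>I. borel)" using Z by (intro measurable_restrict) auto
    have S: "Pi\<^sub>E I A \<in> sets (\<Pi>\<^sub>M i\<in>I. borel)" using I A by (intro sets_PiM_I_finite) auto
    let ?T = "(\<lambda>x. \<lambda>i\<in>I. Z i x) -` Pi\<^sub>E I A \<inter> space P"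
    have "?T \<in> sets P" by (rule measurable_sets[OF _ S]) measurable
    moreover have "(\<Prod>i\<in>I. indicator (A i) (Z i x)) = (indicator ?T x :: real)" if "x \<in> space P" for x
      using I that by (auto simp: indicator_def prod_eq_1_iff PiE_iff)
    then have "(LINT x|P. (\<Prod>i\<in>I. indicator (A i) (Z i x)) * cos ((\<Sum>i\<in>I. 0 * Z i x) + 0)) = (LINT x|P. indicator ?T x)"
      by (intro Bochner_Integration.integral_cong) auto
    ultimately show ?thesis using S by (simp add: emeasure_distr P.emeasure_eq_measure)
  qed
  show ?thesis
  proof (rule measure_eqI_PiM_finite[OF I, where A = "\<lambda>_. space (\<Pi>\<^sub>M i\<in>I. borel)"])
    fix A :: "'i \<Rightarrow> real set" assume "\<And>i. i \<in> I \<Longrightarrow> A i \<in> sets borel"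
    then show "emeasure ?D (Pi\<^sub>E I A) = emeasure ?E (Pi\<^sub>E I A)"
      using rect[OF M X] rect[OF N Y] rectangle_cos_integral_eq[OF M N I X Y eq I subset_refl, of A "\<lambda>_. 0" 0]
      by simp
  next
    show "range (\<lambda>_::nat. space (\<Pi>\<^sub>M i\<in>I. borel :: real measure)) \<subseteq> prod_algebra I (\<lambda>i. borel)"
      using I by (auto simp: space_PiM intro!: prod_algebraI_finite)
    interpret D: prob_space ?D by (rule M.prob_space_distr) measurable
    show "emeasure ?D (space (\<Pi>\<^sub>M i\<in>I. borel)) \<noteq> \<infinity>" by simp
  qed auto
qed

section \<open>Centered Gaussian families\<close>

lemma char_gaussian_measure:
  assumes "0 \<le> s"
  shows "char (gaussian_measure \<mu> s) t = iexp (t * \<mu>) * complex_of_real (exp (- (s\<^sup>2 * t\<^sup>2) / 2))"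
proof (cases "s = 0")
  case True
  have "char (return borel \<mu>) t = iexp (t * \<mu>)"
    unfolding char_def by (subst integral_return) auto
  then show ?thesis using True by (simp add: gaussian_measure_def)
next
  case False
  then have s: "0 < s" using assms by simp
  let ?D = "density lborel (\<lambda>x. ennreal (normal_density \<mu> s x))"
  interpret D: prob_space ?D by (rule prob_space_normal_density) fact
  have "distributed ?D lborel (\<lambda>x. x) (normal_density \<mu> s)"
    by (auto simp: distributed_def distr_id2)
  then have "distributed ?D lborel (\<lambda>x. (x - \<mu>) / s) std_normal_density"
    using D.normal_standard_normal_convert[of s "\<lambda>x. x" \<mu>] s by simp
  then have std: "distr ?D lborel (\<lambda>x. (x - \<mu>) / s) = std_normal_distribution"
    by (simp add: distributed_def)
  have "char ?D t = (CLINT x|?D. iexp (t * \<mu>) * iexp ((s * t) * ((x - \<mu>) / s)))"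
    unfolding char_def
    by (intro Bochner_Integration.integral_cong refl, subst exp_add[symmetric]) (use s in \<open>auto simp: field_simps\<close>)
  also have "\<dots> = iexp (t * \<mu>) * (CLINT x|?D. iexp ((s * t) * ((x - \<mu>) / s)))" by simp
  also have "(CLINT x|?D. iexp ((s * t) * ((x - \<mu>) / s))) = char (distr ?D lborel (\<lambda>x. (x - \<mu>) / s)) (s * t)"
    unfolding char_def by (subst integral_distr) auto
  also have "\<dots> = complex_of_real (exp (- (s\<^sup>2 * t\<^sup>2) / 2))"
    unfolding std char_std_normal_distribution by (simp add: power_mult_distrib)
  finally show ?thesis using False by (simp add: gaussian_measure_def)
qed

text \<open>The parameters that \<open>gaussian_rv\<close> merely asserts to exist are recovered as
  mean and standard deviation, also for a point mass, so that later arguments can compute with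
  moments.\<close>

lemma (in prob_space) gaussian_rv_moments:
  assumes "gaussian_rv M X"
  obtains s where "0 \<le> s" "distr M borel X = gaussian_measure (expectation X) s"
    "integrable M X" "integrable M (\<lambda>x. (X x)\<^sup>2)" "variance X = s\<^sup>2"
proof -
  from assms obtain \<mu> s where [measurable]: "X \<in> borel_measurable M" and s: "0 \<le> s"
    and D: "distr M borel X = gaussian_measure \<mu> s" unfolding gaussian_rv_def by auto
  show ?thesis
  proof (cases "s = 0")
    case True
    have D': "distr M borel X = return borel \<mu>" using D True by (simp add: gaussian_measure_def)
    have "AE y in distr M borel X. y = \<mu>" unfolding D' by (subst AE_return) auto
    then have ae: "AE x in M. X x = \<mu>" by (subst (asm) AE_distr_iff) auto
    have i1: "integrable M X" using ae by (subst integrable_cong_AE[where g="\<lambda>_. \<mu>"]) auto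
    have i2: "integrable M (\<lambda>x. (X x)\<^sup>2)" using ae by (subst integrable_cong_AE[where g="\<lambda>_. \<mu>\<^sup>2"]) auto
    have e: "expectation X = \<mu>" using ae by (subst integral_cong_AE[where g="\<lambda>_. \<mu>"]) (auto simp: prob_space)
    have "variance X = 0" unfolding e using ae by (subst integral_cong_AE[where g="\<lambda>_. 0"]) auto
    then show ?thesis using that[OF s] i1 i2 e D True by simp
  next
    case False
    then have s0: "0 < s" using s by simp
    have "distr M lborel X = distr M borel X" by (rule distr_cong) auto
    then have d: "distributed M lborel X (normal_density \<mu> s)"
      using D False by (simp add: distributed_def gaussian_measure_def)
    have e: "expectation X = \<mu>" using normal_distributed_expectation[OF s0 d] .
    have v: "variance X = s\<^sup>2" using normal_distributed_variance[OF s0 d] .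
    have i2: "integrable M (\<lambda>x. (X x)\<^sup>2)"
    proof -
      have "integrable lborel (\<lambda>x. normal_density \<mu> s x * (x - \<mu>)^1)" "integrable lborel (\<lambda>x. normal_density \<mu> s x * (x - \<mu>)^2)"
        "integrable lborel (\<lambda>x. normal_density \<mu> s x)"
        using integrable_normal_moment[OF s0, of \<mu> 1] integrable_normal_moment[OF s0, of \<mu> 2] s0 by auto
      then have "integrable lborel (\<lambda>x. normal_density \<mu> s x * (x - \<mu>)^2 + (2 * \<mu>) * (normal_density \<mu> s x * (x - \<mu>)^1) + \<mu>\<^sup>2 * normal_density \<mu> s x)"
        by (intro Bochner_Integration.integrable_add integrable_mult_right) auto
      then have "integrable lborel (\<lambda>x. normal_density \<mu> s x * x\<^sup>2)"
        by (rule back_subst[where P="integrable lborel"]) (auto simp: fun_eq_iff power2_eq_square algebra_simps)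
      then show ?thesis using d by (subst distributed_integrable[OF d, symmetric]) auto
    qed
    have i1: "integrable M X" by (rule square_integrable_imp_integrable[OF _ i2]) simp
    show ?thesis using that[OF s] i1 i2 e v D by simp
  qed
qed

text \<open>Phrasing the definition by characteristic functions includes singular covariance matrices.\<close>

definition centered_gaussian :: "'a measure \<Rightarrow> 'i set \<Rightarrow> ('i \<Rightarrow> 'a \<Rightarrow> real) \<Rightarrow> bool" where
  "centered_gaussian M I X \<longleftrightarrow>
     (\<forall>i\<in>I. X i \<in> borel_measurable M \<and> integrable M (\<lambda>x. (X i x)\<^sup>2)) \<and>
     (\<forall>a. (CLINT x|M. iexp (\<Sum>i\<in>I. a i * X i x)) =
        complex_of_real (exp (- (LINT x|M. (\<Sum>i\<in>I. a i * X i x)\<^sup>2) / 2)))"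

text \<open>Each linear form is a one-dimensional Gaussian, and its characteristic function at 1 is
  the joint one at the coefficient vector. Mean zero turns the variance in it into the second
  moment.\<close>

lemma jointly_gaussian_imp_centered_gaussian:
  fixes X :: "'i \<Rightarrow> 'a \<Rightarrow> real"
  assumes "prob_space M" "finite I" "jointly_gaussian M I X" "\<And>i. i \<in> I \<Longrightarrow> prob_space.expectation M (X i) = 0"
  shows "centered_gaussian M I X"
proof -
  interpret prob_space M by fact
  have g: "gaussian_rv M (\<lambda>x. \<Sum>i\<in>I. a i * X i x)" for a
    using assms(3) by (simp add: jointly_gaussian_def)
  have gi: "gaussian_rv M (X i)" if "i \<in> I" for i
    using g[of "\<lambda>k. if k = i then 1 else 0"] that assms(2)
    by (simp add: if_distrib[of "\<lambda>u. u * _"] sum.delta cong: if_cong)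
  have meas: "X i \<in> borel_measurable M" if "i \<in> I" for i using gi[OF that] by (simp add: gaussian_rv_def)
  have int: "integrable M (X i)" "integrable M (\<lambda>x. (X i x)\<^sup>2)" if "i \<in> I" for i
    by (rule gaussian_rv_moments[OF gi[OF that]], assumption)+
  have "(CLINT x|M. iexp (\<Sum>i\<in>I. a i * X i x)) = complex_of_real (exp (- (LINT x|M. (\<Sum>i\<in>I. a i * X i x)\<^sup>2) / 2))" for a
  proof -
    let ?S = "\<lambda>x. \<Sum>i\<in>I. a i * X i x"
    have [measurable]: "?S \<in> borel_measurable M" using meas by simp
    have e: "expectation ?S = 0" using int assms(4) by simp
    obtain s where s: "0 \<le> s" "distr M borel ?S = gaussian_measure 0 s" "variance ?S = s\<^sup>2"
      by (rule gaussian_rv_moments[OF g[of a]]) (simp only: e)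
    have "(CLINT x|M. iexp (?S x)) = char (distr M borel ?S) 1"
      unfolding char_def by (subst integral_distr) auto
    then show ?thesis using s e char_gaussian_measure[OF s(1), of 0 1] by simp
  qed
  then show ?thesis using meas int by (simp add: centered_gaussian_def)
qed

lemma square_integrable_mult:
  fixes f g :: "'a \<Rightarrow> real"
  assumes [measurable]: "f \<in> borel_measurable M" "g \<in> borel_measurable M"
    and "integrable M (\<lambda>x. (f x)\<^sup>2)" "integrable M (\<lambda>x. (g x)\<^sup>2)"
  shows "integrable M (\<lambda>x. f x * g x)"
proof (rule Bochner_Integration.integrable_bound)
  show "integrable M (\<lambda>x. (f x)\<^sup>2 + (g x)\<^sup>2)" using assms by simp
  have "\<bar>f x * g x\<bar> \<le> (f x)\<^sup>2 + (g x)\<^sup>2" for x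
  proof -
    have "2 * (\<bar>f x\<bar> * \<bar>g x\<bar>) \<le> (f x)\<^sup>2 + (g x)\<^sup>2"
      using sum_squares_bound[of "\<bar>f x\<bar>" "\<bar>g x\<bar>"] by (simp add: mult.assoc)
    moreover have "0 \<le> \<bar>f x\<bar> * \<bar>g x\<bar>" by simp
    ultimately show ?thesis unfolding abs_mult by linarith
  qed
  then show "AE x in M. norm (f x * g x) \<le> norm ((f x)\<^sup>2 + (g x)\<^sup>2)" by simp
qed simp

lemma square_integrable_sum:
  fixes X :: "'i \<Rightarrow> 'a \<Rightarrow> real"
  assumes X: "\<And>i. i \<in> I \<Longrightarrow> X i \<in> borel_measurable M" "\<And>i. i \<in> I \<Longrightarrow> integrable M (\<lambda>x. (X i x)\<^sup>2)"
  shows "integrable M (\<lambda>x. (\<Sum>i\<in>I. a i * X i x)\<^sup>2)"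
proof -
  have "(\<Sum>i\<in>I. a i * X i x)\<^sup>2 = (\<Sum>i\<in>I. \<Sum>k\<in>I. (a i * a k) * (X i x * X k x))" for x
    by (simp add: power2_eq_square sum_product mult_ac)
  then show ?thesis
    using X by (auto intro!: Bochner_Integration.integrable_sum integrable_mult_right square_integrable_mult)
qed

text \<open>A linear form in the new family is a linear form in the old one with collected
  coefficients, and the defining equation ranges over all linear forms. Subfamilies and regression
  residuals are obtained this way.\<close>

lemma centered_gaussian_linear_image:
  assumes "centered_gaussian M I X" "finite I"
  shows "centered_gaussian M K (\<lambda>k x. \<Sum>i\<in>I. b k i * X i x)"
proof -
  have eq: "(\<Sum>k\<in>K. a k * (\<Sum>i\<in>I. b k i * X i x)) = (\<Sum>i\<in>I. (\<Sum>k\<in>K. a k * b k i) * X i x)" for a x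
    by (simp add: sum_distrib_left sum_distrib_right mult.assoc sum.swap[of _ I K])
  have X: "\<And>i. i \<in> I \<Longrightarrow> X i \<in> borel_measurable M" "\<And>i. i \<in> I \<Longrightarrow> integrable M (\<lambda>x. (X i x)\<^sup>2)"
    using assms(1) by (auto simp: centered_gaussian_def)
  show ?thesis
    unfolding centered_gaussian_def eq
  proof (intro conjI ballI allI)
    show "(\<lambda>x. \<Sum>i\<in>I. b k i * X i x) \<in> borel_measurable M" for k using X(1) by simp
    show "integrable M (\<lambda>x. (\<Sum>i\<in>I. b k i * X i x)\<^sup>2)" for k by (rule square_integrable_sum) (use X in auto)
  qed (use assms(1) in \<open>simp add: centered_gaussian_def del: of_real_sum of_real_mult\<close>)
qed

lemma centered_gaussian_subset:
  assumes "centered_gaussian M I X" "finite I" "J \<subseteq> I"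
  shows "centered_gaussian M J X"
proof -
  have "(\<Sum>i\<in>I. (if k = i then 1 else 0) * X i x) = X k x" if "k \<in> J" for k x
    using that assms(2,3) by (auto simp: if_distrib[of "\<lambda>u. u * _"] sum.delta' cong: if_cong)
  then show ?thesis
    using centered_gaussian_linear_image[OF assms(1,2), of J "\<lambda>k i. if k = i then 1 else 0"]
    by (simp add: centered_gaussian_def)
qed

lemma cramer_wold_integral:
  fixes X :: "'i \<Rightarrow> 'a \<Rightarrow> real" and Y :: "'i \<Rightarrow> 'b \<Rightarrow> real" and \<Phi> :: "('i \<Rightarrow> real) \<Rightarrow> real"
  assumes M: "prob_space M" and N: "prob_space N" and I: "finite I"
    and X: "\<And>i. i \<in> I \<Longrightarrow> X i \<in> borel_measurable M"
    and Y: "\<And>i. i \<in> I \<Longrightarrow> Y i \<in> borel_measurable N"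
    and eq: "\<And>a. (CLINT x|M. iexp (\<Sum>i\<in>I. a i * X i x)) = (CLINT x|N. iexp (\<Sum>i\<in>I. a i * Y i x))"
    and \<Phi>: "\<Phi> \<in> borel_measurable (\<Pi>\<^sub>M i\<in>I. borel)"
  shows "(LINT x|M. \<Phi> (\<lambda>i\<in>I. X i x)) = (LINT x|N. \<Phi> (\<lambda>i\<in>I. Y i x))"
proof -
  have 1: "(LINT x|M. \<Phi> (\<lambda>i\<in>I. X i x)) = integral\<^sup>L (distr M (\<Pi>\<^sub>M i\<in>I. borel) (\<lambda>x. \<lambda>i\<in>I. X i x)) \<Phi>"
    using X by (intro integral_distr[symmetric] \<Phi> measurable_restrict) auto
  have 2: "(LINT x|N. \<Phi> (\<lambda>i\<in>I. Y i x)) = integral\<^sup>L (distr N (\<Pi>\<^sub>M i\<in>I. borel) (\<lambda>x. \<lambda>i\<in>I. Y i x)) \<Phi>"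
    using Y by (intro integral_distr[symmetric] \<Phi> measurable_restrict) auto
  show ?thesis unfolding 1 2 using cramer_wold[OF M N I X Y eq] by simp
qed

lemma centered_gaussian_cong:
  assumes "\<And>i x. i \<in> I \<Longrightarrow> X i x = Y i x"
  shows "centered_gaussian M I X \<longleftrightarrow> centered_gaussian M I Y"
proof -
  have 1: "(\<Sum>i\<in>I. a i * X i x) = (\<Sum>i\<in>I. a i * Y i x)" for a x
    using assms by (intro sum.cong) auto
  have 2: "X i = Y i" if "i \<in> I" for i using assms[OF that] by (simp add: fun_eq_iff)
  have "(\<forall>i\<in>I. X i \<in> borel_measurable M \<and> integrable M (\<lambda>x. (X i x)\<^sup>2)) \<longleftrightarrow>
      (\<forall>i\<in>I. Y i \<in> borel_measurable M \<and> integrable M (\<lambda>x. (Y i x)\<^sup>2))"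
    by (intro ball_cong refl) (simp add: 2)
  then show ?thesis unfolding centered_gaussian_def 1 by simp
qed

section \<open>Probabilities of shifted slabs\<close>

lemma prod_indicator_eq:
  "finite I \<Longrightarrow> (\<Prod>i\<in>I. indicat_real (A i) (z i)) = of_bool (\<forall>i\<in>I. z i \<in> A i)"
  by (induction I rule: finite_induct) (auto simp: indicator_def)

lemma slab_integrand_measurable:
  fixes f :: "'i \<Rightarrow> 'a \<Rightarrow> real"
  assumes "\<And>i. i \<in> I \<Longrightarrow> f i \<in> borel_measurable M"
  shows "(\<lambda>x. \<Prod>i\<in>I. indicat_real {l i..u i} (f i x)) \<in> borel_measurable M"
proof (rule borel_measurable_prod)
  fix i assume "i \<in> I"
  then show "(\<lambda>x. indicat_real {l i..u i} (f i x)) \<in> borel_measurable M"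
    by (intro measurable_compose[where N = borel, OF assms borel_measurable_indicator]) auto
qed

text \<open>An integral instead of the measure of an event, so that coordinates can be split off by Fubini's
  theorem.\<close>

definition slab_prob :: "'a measure \<Rightarrow> 'i set \<Rightarrow> ('i \<Rightarrow> 'a \<Rightarrow> real) \<Rightarrow> ('i \<Rightarrow> real) \<Rightarrow> ('i \<Rightarrow> real) \<Rightarrow> real" where
  "slab_prob M I X c b = (LINT x|M. (\<Prod>i\<in>I. indicat_real {- c i..c i} (X i x + b i)))"

lemma slab_prob_eq_measure:
  assumes "prob_space M" "finite I" "\<And>i. i \<in> I \<Longrightarrow> X i \<in> borel_measurable M"
  shows "slab_prob M I X c (\<lambda>_. 0) = measure M {x \<in> space M. \<forall>i\<in>I. \<bar>X i x\<bar> \<le> c i}"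
proof -
  interpret prob_space M by fact
  let ?A = "{x \<in> space M. \<forall>i\<in>I. \<bar>X i x\<bar> \<le> c i}"
  have "{x \<in> space M. \<bar>X i x\<bar> \<le> c i} \<in> sets M" if "i \<in> I" for i
    using assms(3)[OF that] by measurable
  then have "?A \<in> sets M" using assms(2) by (intro sets.sets_Collect_finite_All) auto
  moreover have "slab_prob M I X c (\<lambda>_. 0) = (LINT x|M. indicator ?A x)"
    unfolding slab_prob_def using assms(2)
    unfolding prod_indicator_eq[OF assms(2)]
    by (intro Bochner_Integration.integral_cong) (auto simp: indicator_def abs_le_iff minus_le_iff)
  ultimately show ?thesis by simp
qed

text \<open>The characteristic function involves second moments only, so \<open>X\<close> and
  \<open>- X\<close> have the same law; reflecting the symmetric intervals turns the shift
  \<open>- b\<close> into \<open>b\<close>.\<close>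

lemma slab_prob_uminus:
  assumes M: "prob_space M" and I: "finite I" and X: "centered_gaussian M I X"
  shows "slab_prob M I X c (\<lambda>i. - b i) = slab_prob M I X c b"
proof -
  have meas: "X i \<in> borel_measurable M" if "i \<in> I" for i using X that by (simp add: centered_gaussian_def)
  let ?\<Phi> = "\<lambda>z. \<Prod>i\<in>I. indicat_real {- c i..c i} (z i - b i) :: real"
  have "(LINT x|M. ?\<Phi> (\<lambda>i\<in>I. X i x)) = (LINT x|M. ?\<Phi> (\<lambda>i\<in>I. - X i x))"
  proof (rule cramer_wold_integral[OF M M I])
    fix a
    have X': "(CLINT x|M. iexp (\<Sum>i\<in>I. a i * X i x)) = complex_of_real (exp (- (LINT x|M. (\<Sum>i\<in>I. a i * X i x)\<^sup>2) / 2))" for a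
      using X unfolding centered_gaussian_def by blast
    have "(CLINT x|M. iexp (\<Sum>i\<in>I. a i * - X i x)) = (CLINT x|M. iexp (\<Sum>i\<in>I. (- a i) * X i x))" by simp
    also have "\<dots> = complex_of_real (exp (- (LINT x|M. (\<Sum>i\<in>I. (- a i) * X i x)\<^sup>2) / 2))"
      by (rule X')
    also have "\<dots> = complex_of_real (exp (- (LINT x|M. (\<Sum>i\<in>I. a i * X i x)\<^sup>2) / 2))"
      by (simp add: sum_negf)
    also have "\<dots> = (CLINT x|M. iexp (\<Sum>i\<in>I. a i * X i x))"
      by (rule X'[symmetric])
    finally show "(CLINT x|M. iexp (\<Sum>i\<in>I. a i * X i x)) = (CLINT x|M. iexp (\<Sum>i\<in>I. a i * - X i x))" ..
  next
    show "?\<Phi> \<in> borel_measurable (Pi\<^sub>M I (\<lambda>i. borel))"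
      by (intro slab_integrand_measurable borel_measurable_diff) auto
  qed (use meas in auto)
  then have "(LINT x|M. (\<Prod>i\<in>I. indicat_real {- c i..c i} (X i x - b i))) =
     (LINT x|M. (\<Prod>i\<in>I. indicat_real {- c i..c i} (- X i x - b i)))" by simp
  also have "\<dots> = (LINT x|M. (\<Prod>i\<in>I. indicat_real {- c i..c i} (X i x + b i)))"
    by (intro Bochner_Integration.integral_cong prod.cong) (auto simp: indicator_def)
  finally show ?thesis by (simp add: slab_prob_def)
qed

lemma slab_prob_bounds:
  assumes "prob_space M"
  shows "0 \<le> slab_prob M I X c b" "slab_prob M I X c b \<le> 1"
proof -
  interpret prob_space M by fact
  show "0 \<le> slab_prob M I X c b" unfolding slab_prob_def
    by (intro integral_nonneg_AE AE_I2 prod_nonneg) auto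
  \<comment> \<open>No measurability of \<open>X\<close> is assumed; a non-integrable integrand has
    Bochner integral 0, which satisfies the bound as well.\<close>
  show "slab_prob M I X c b \<le> 1" unfolding slab_prob_def
    by (cases "integrable M (\<lambda>x. \<Prod>i\<in>I. indicat_real {- c i..c i} (X i x + b i) :: real)")
      (auto intro!: integral_le_const prod_le_1 simp: indicator_def not_integrable_integral_eq)
qed

lemma slab_prob_measurable:
  assumes "prob_space M" "\<And>i. i \<in> I \<Longrightarrow> X i \<in> borel_measurable M"
  shows "(\<lambda>t. slab_prob M I X c (\<lambda>i. b i + r i * t)) \<in> borel_measurable borel"
proof -
  interpret prob_space M by fact
  have "(\<lambda>p. \<Prod>i\<in>I. indicat_real {- c i..c i} (X i (snd p) + (b i + r i * fst p)) :: real) \<in> borel_measurable (borel \<Otimes>\<^sub>M M)"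
  proof (rule slab_integrand_measurable)
    fix i assume "i \<in> I"
    then have [measurable]: "X i \<in> borel_measurable M" by (rule assms(2))
    show "(\<lambda>p. X i (snd p) + (b i + r i * fst p)) \<in> borel_measurable (borel \<Otimes>\<^sub>M M)" by measurable
  qed
  then show ?thesis
    unfolding slab_prob_def by (intro borel_measurable_lebesgue_integral) (simp add: case_prod_beta)
qed

text \<open>If \<open>X\<close> vanishes almost everywhere, the quotient is \<open>0 / 0 = 0\<close>, and the residual is still
  uncorrelated with \<open>X\<close>.\<close>

definition regression_coeff :: "'a measure \<Rightarrow> ('a \<Rightarrow> real) \<Rightarrow> ('a \<Rightarrow> real) \<Rightarrow> real" where
  "regression_coeff M X Y = (LINT x|M. X x * Y x) / (LINT x|M. (X x)\<^sup>2)"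

lemma residual_uncorrelated:
  fixes X Y :: "'a \<Rightarrow> real"
  assumes [measurable]: "X \<in> borel_measurable M" "Y \<in> borel_measurable M"
    and "integrable M (\<lambda>x. (X x)\<^sup>2)" "integrable M (\<lambda>x. (Y x)\<^sup>2)"
  shows "(LINT x|M. X x * (Y x - regression_coeff M X Y * X x)) = 0"
proof (cases "(LINT x|M. (X x)\<^sup>2) = 0")
  case True
  then have "AE x in M. (X x)\<^sup>2 = 0"
    using integral_nonneg_eq_0_iff_AE[OF assms(3)] by simp
  then show ?thesis by (intro integral_eq_zero_AE) auto
next
  case False
  have "(LINT x|M. X x * (Y x - regression_coeff M X Y * X x)) =
    (LINT x|M. X x * Y x - regression_coeff M X Y * (X x)\<^sup>2)"
    by (simp add: algebra_simps power2_eq_square)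
  also have "\<dots> = (LINT x|M. X x * Y x) - regression_coeff M X Y * (LINT x|M. (X x)\<^sup>2)"
    using assms square_integrable_mult[OF assms] by simp
  finally show ?thesis using False by (simp add: regression_coeff_def)
qed

section \<open>Independence of the regression residuals\<close>

lemma integral_product_iexp:
  fixes f g :: "'a \<Rightarrow> real"
  assumes "prob_space M" and [measurable]: "f \<in> borel_measurable M" "g \<in> borel_measurable M"
  shows "(CLINT p|(M \<Otimes>\<^sub>M M). iexp (f (fst p) + g (snd p))) = (CLINT x|M. iexp (f x)) * (CLINT x|M. iexp (g x))"
proof -
  interpret prob_space M by fact
  interpret pair_prob_space M M by unfold_locales
  have "integrable (M \<Otimes>\<^sub>M M) (\<lambda>p. iexp (f (fst p) + g (snd p)))"
    by (rule P.integrable_iexp) auto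
  then have "(CLINT p|(M \<Otimes>\<^sub>M M). iexp (f (fst p) + g (snd p))) = (CLINT x|M. CLINT y|M. iexp (f x + g y))"
    using integral_fst'[of "\<lambda>p. iexp (f (fst p) + g (snd p))"] by simp
  also have "\<dots> = (CLINT x|M. CLINT y|M. iexp (f x) * iexp (g y))"
    by (simp add: exp_add[symmetric] algebra_simps)
  also have "\<dots> = (CLINT x|M. iexp (f x)) * (CLINT x|M. iexp (g x))"
    by simp
  finally show ?thesis .
qed

text \<open>The mixed integral on the right expresses that the residuals \<open>W\<close> are independent of \<open>X j\<close>.\<close>

lemma gaussian_regression:
  fixes X :: "'i \<Rightarrow> 'a \<Rightarrow> real"
  assumes M: "prob_space M" and I: "finite I" and j: "j \<notin> I" and X: "centered_gaussian M (insert j I) X"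
    and B: "B \<in> sets borel"
  defines "r \<equiv> \<lambda>i. regression_coeff M (X j) (X i)"
  defines "W \<equiv> \<lambda>i x. X i x - r i * X j x"
  shows "centered_gaussian M I W"
    and "(LINT x|M. indicat_real B (X j x) * (\<Prod>i\<in>I. indicat_real {- c i..c i} (X i x + b i))) =
       (LINT t|distr M borel (X j). indicat_real B t * slab_prob M I W c (\<lambda>i. b i + r i * t))"
proof -
  interpret prob_space M by fact
  interpret pair_prob_space M M by unfold_locales
  let ?I = "insert j I"
  have meas: "X i \<in> borel_measurable M" "integrable M (\<lambda>x. (X i x)\<^sup>2)" if "i \<in> ?I" for i
    using X that unfolding centered_gaussian_def by blast+
  have [measurable]: "X j \<in> borel_measurable M" using meas by simp
  define Z where "Z i x = (if i = j then X j x else W i x)" for i x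
  \<comment> \<open>The change of variables is written with explicit coefficients so that closure
    under linear maps applies; the guard \<open>i \<noteq> j\<close> keeps \<open>X j\<close> itself
    unchanged.\<close>
  have Zlin: "Z i x = (\<Sum>k\<in>?I. ((if k = i then 1 else 0) - (if k = j \<and> i \<noteq> j then r i else 0)) * X k x)" if "i \<in> ?I" for i x
  proof -
    have S: "(\<Sum>k\<in>?I. (if k = n then u else 0) * X k x) = u * X n x" if "n \<in> ?I" for n u
    proof -
      have "(\<Sum>k\<in>?I. (if k = n then u else 0) * X k x) = (\<Sum>k\<in>?I. if k = n then u * X k x else 0)"
        by (rule sum.cong) auto
      also have "\<dots> = u * X n x" using that I by (subst sum.delta) auto
      finally show ?thesis .
    qed
    show ?thesis
    proof (cases "i = j")
      case True
      have "Z i x = 1 * X j x" using True by (simp add: Z_def)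
      also have "\<dots> = (\<Sum>k\<in>?I. (if k = j then 1 else 0) * X k x)" by (rule S[symmetric]) simp
      finally show ?thesis using True by (simp only: simp_thms if_False diff_0_right)
    next
      case False
      have "Z i x = 1 * X i x - r i * X j x" using False by (simp add: Z_def W_def)
      also have "\<dots> = (\<Sum>k\<in>?I. (if k = i then 1 else 0) * X k x) - (\<Sum>k\<in>?I. (if k = j then r i else 0) * X k x)"
        using S[OF that, of 1] S[of j "r i"] by (simp only: insertI1)
      also have "\<dots> = (\<Sum>k\<in>?I. ((if k = i then 1 else 0) - (if k = j then r i else 0)) * X k x)"
        by (simp only: left_diff_distrib sum_subtractf)
      finally show ?thesis using False by (simp only: simp_thms)
    qed
  qed
  have Z: "centered_gaussian M ?I Z"
  proof (rule centered_gaussian_cong[THEN iffD2])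
    show "centered_gaussian M ?I (\<lambda>i x. \<Sum>k\<in>?I. ((if k = i then 1 else 0) - (if k = j \<and> i \<noteq> j then r i else 0)) * X k x)"
      by (rule centered_gaussian_linear_image[OF X]) (use I in simp)
  qed (rule Zlin)
  have "centered_gaussian M I Z" by (rule centered_gaussian_subset[OF Z]) (use I in auto)
  moreover have ZW: "Z i = W i" if "i \<in> I" for i using that j by (auto simp: Z_def fun_eq_iff)
  ultimately show W: "centered_gaussian M I W" using centered_gaussian_cong[of I Z W M] by simp
  have measW: "W i \<in> borel_measurable M" "integrable M (\<lambda>x. (W i x)\<^sup>2)" if "i \<in> I" for i
    using W that unfolding centered_gaussian_def by blast+
  \<comment> \<open>On the product space \<open>X j\<close> depends on the first component and the
    residuals on the second, so they are independent by construction. \<open>Z\<close> and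
    \<open>Z'\<close> have the same characteristic function because the mixed second moment of
    \<open>X j\<close> and the residuals vanishes. The functional \<open>?\<Phi>\<close> below
    undoes the change of variables by \<open>X i = W i + r i * X j\<close>.\<close>
  define Z' where "Z' i p = (if i = j then X j (fst p) else W i (snd p))" for i and p :: "'a \<times> 'a"
  let ?\<Phi> = "\<lambda>z. indicat_real B (z j) * (\<Prod>i\<in>I. indicat_real {- c i..c i} (z i + r i * z j + b i)) :: real"
  have "(LINT x|M. ?\<Phi> (\<lambda>i\<in>?I. Z i x)) = (LINT p|(M \<Otimes>\<^sub>M M). ?\<Phi> (\<lambda>i\<in>?I. Z' i p))"
  proof (rule cramer_wold_integral[OF M P.prob_space_axioms])
    show "finite ?I" using I by simp
    show "Z i \<in> borel_measurable M" if "i \<in> ?I" for i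
      using Z that unfolding centered_gaussian_def by blast
    show "Z' i \<in> borel_measurable (M \<Otimes>\<^sub>M M)" if "i \<in> ?I" for i
    proof (cases "i = j")
      case False
      then have "W i \<in> borel_measurable M" using measW that by simp
      then show ?thesis using False unfolding Z'_def[abs_def] by simp
    qed (simp add: Z'_def[abs_def])
    show "?\<Phi> \<in> borel_measurable (Pi\<^sub>M ?I (\<lambda>i. borel))"
    proof (intro borel_measurable_times slab_integrand_measurable)
      show "(\<lambda>z. indicat_real B (z j)) \<in> borel_measurable (Pi\<^sub>M ?I (\<lambda>i. borel))"
        using B by (intro measurable_compose[where N = borel, OF _ borel_measurable_indicator]) auto
    qed auto
  next
    fix a
    define S where "S x = (\<Sum>i\<in>I. a i * W i x)" for x
    have [measurable]: "S \<in> borel_measurable M" unfolding S_def[abs_def] using measW by simp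
    have S2: "integrable M (\<lambda>x. (S x)\<^sup>2)" unfolding S_def by (rule square_integrable_sum) (use measW in auto)
    have uncor: "(LINT x|M. X j x * S x) = 0"
    proof -
      have 0: "(LINT x|M. X j x * W i x) = 0" if "i \<in> I" for i
        unfolding W_def r_def by (rule residual_uncorrelated) (use meas that in auto)
      have "(LINT x|M. X j x * S x) = (LINT x|M. (\<Sum>i\<in>I. a i * (X j x * W i x)))"
        by (simp add: S_def sum_distrib_left mult.left_commute)
      also have "\<dots> = (\<Sum>i\<in>I. a i * (LINT x|M. X j x * W i x))"
        using measW meas by (subst Bochner_Integration.integral_sum) (auto intro!: integrable_mult_right square_integrable_mult)
      also have "\<dots> = 0"
        by (intro sum.neutral ballI) (simp only: 0 mult_zero_right)
      finally show ?thesis .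
    qed
    have "(LINT x|M. (\<Sum>i\<in>?I. a i * Z i x)\<^sup>2) = (LINT x|M. (a j)\<^sup>2 * (X j x)\<^sup>2 + (2 * a j * (X j x * S x) + (S x)\<^sup>2))"
    proof (intro Bochner_Integration.integral_cong refl)
      fix x
      have "(\<Sum>i\<in>?I. a i * Z i x) = a j * X j x + S x"
        using I j ZW by (simp add: S_def) (simp add: Z_def)
      then show "(\<Sum>i\<in>?I. a i * Z i x)\<^sup>2 = (a j)\<^sup>2 * (X j x)\<^sup>2 + (2 * a j * (X j x * S x) + (S x)\<^sup>2)"
        by (simp add: power2_eq_square algebra_simps)
    qed
    also have "\<dots> = (LINT x|M. (a j * X j x)\<^sup>2) + (LINT x|M. (S x)\<^sup>2)"
      using meas(2)[of j] S2 square_integrable_mult[of "X j" M S] uncor by (simp add: power_mult_distrib)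
    finally have E: "(LINT x|M. (\<Sum>i\<in>?I. a i * Z i x)\<^sup>2) = (LINT x|M. (a j * X j x)\<^sup>2) + (LINT x|M. (S x)\<^sup>2)" .
    have "(CLINT p|(M \<Otimes>\<^sub>M M). iexp (\<Sum>i\<in>?I. a i * Z' i p)) = (CLINT p|(M \<Otimes>\<^sub>M M). iexp (a j * X j (fst p) + S (snd p)))"
    proof (intro Bochner_Integration.integral_cong refl)
      fix p
      have "(\<Sum>i\<in>?I. a i * Z' i p) = a j * X j (fst p) + S (snd p)"
        using I j by (simp add: S_def Z'_def) (intro sum.cong, auto)
      then show "iexp (\<Sum>i\<in>?I. a i * Z' i p) = iexp (a j * X j (fst p) + S (snd p))" by simp
    qed
    also have "\<dots> = (CLINT x|M. iexp (a j * X j x)) * (CLINT x|M. iexp (S x))"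
      by (rule integral_product_iexp[OF M]) auto
    also have "(CLINT x|M. iexp (a j * X j x)) = complex_of_real (exp (- (LINT x|M. (a j * X j x)\<^sup>2) / 2))"
    proof -
      have "centered_gaussian M {j} X" by (rule centered_gaussian_subset[OF X]) (use I in auto)
      then show ?thesis unfolding centered_gaussian_def by (auto dest: spec[of _ a])
    qed
    also have "(CLINT x|M. iexp (S x)) = complex_of_real (exp (- (LINT x|M. (S x)\<^sup>2) / 2))"
      using W unfolding centered_gaussian_def S_def by blast
    also have "complex_of_real (exp (- (LINT x|M. (a j * X j x)\<^sup>2) / 2)) * complex_of_real (exp (- (LINT x|M. (S x)\<^sup>2) / 2))
       = complex_of_real (exp (- (LINT x|M. (\<Sum>i\<in>?I. a i * Z i x)\<^sup>2) / 2))"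
      unfolding E of_real_mult[symmetric] exp_add[symmetric] by (simp add: add_divide_distrib)
    also have "\<dots> = (CLINT x|M. iexp (\<Sum>i\<in>?I. a i * Z i x))"
      using Z unfolding centered_gaussian_def by metis
    finally show "(CLINT x|M. iexp (\<Sum>i\<in>?I. a i * Z i x)) = (CLINT p|(M \<Otimes>\<^sub>M M). iexp (\<Sum>i\<in>?I. a i * Z' i p))" ..
  qed
  moreover have "?\<Phi> (\<lambda>i\<in>?I. Z i x) = indicat_real B (X j x) * (\<Prod>i\<in>I. indicat_real {- c i..c i} (X i x + b i))" for x
    using ZW by (simp add: Z_def[of j]) (simp add: W_def)
  moreover have "?\<Phi> (\<lambda>i\<in>?I. Z' i p) = indicat_real B (X j (fst p)) * (\<Prod>i\<in>I. indicat_real {- c i..c i} (W i (snd p) + (b i + r i * X j (fst p))))" for p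
  proof -
    have "(\<Prod>i\<in>I. indicat_real {- c i..c i} ((\<lambda>i\<in>?I. Z' i p) i + r i * (\<lambda>i\<in>?I. Z' i p) j + b i)) =
      (\<Prod>i\<in>I. indicat_real {- c i..c i} (W i (snd p) + (b i + r i * X j (fst p))) :: real)"
      using j by (intro prod.cong refl arg_cong[where f="indicator _"]) (auto simp: Z'_def)
    then show ?thesis by (simp add: Z'_def[of j])
  qed
  ultimately have "(LINT x|M. indicat_real B (X j x) * (\<Prod>i\<in>I. indicat_real {- c i..c i} (X i x + b i))) =
     (LINT p|(M \<Otimes>\<^sub>M M). indicat_real B (X j (fst p)) * (\<Prod>i\<in>I. indicat_real {- c i..c i} (W i (snd p) + (b i + r i * X j (fst p)))))"
    by simp
  also have "\<dots> = (LINT x|M. (LINT y|M. indicat_real B (X j x) * (\<Prod>i\<in>I. indicat_real {- c i..c i} (W i y + (b i + r i * X j x)))))"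
  proof -
    let ?f = "\<lambda>p. indicat_real B (X j (fst p)) * (\<Prod>i\<in>I. indicat_real {- c i..c i} (W i (snd p) + (b i + r i * X j (fst p)))) :: real"
    have "?f \<in> borel_measurable (M \<Otimes>\<^sub>M M)"
    proof (intro borel_measurable_times slab_integrand_measurable)
      have [measurable]: "B \<in> sets borel" by (rule B)
      show "(\<lambda>p. indicat_real B (X j (fst p))) \<in> borel_measurable (M \<Otimes>\<^sub>M M)" by measurable
    next
      fix i assume "i \<in> I"
      then have [measurable]: "W i \<in> borel_measurable M" using measW by simp
      show "(\<lambda>p. W i (snd p) + (b i + r i * X j (fst p))) \<in> borel_measurable (M \<Otimes>\<^sub>M M)" by measurable
    qed
    moreover have "norm (?f p) \<le> 1" for p
      unfolding prod_indicator_eq[OF I] by (simp add: indicator_def)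
    ultimately have "integrable (M \<Otimes>\<^sub>M M) ?f"
      by (intro P.integrable_const_bound[of _ 1] AE_I2)
    then show ?thesis using integral_fst'[of ?f] by simp
  qed
  also have "\<dots> = (LINT x|M. indicat_real B (X j x) * slab_prob M I W c (\<lambda>i. b i + r i * X j x))"
    by (simp add: slab_prob_def)
  also have "\<dots> = (LINT t|distr M borel (X j). indicat_real B t * slab_prob M I W c (\<lambda>i. b i + r i * t))"
  proof (rule integral_distr[symmetric])
    show "(\<lambda>t. indicat_real B t * slab_prob M I W c (\<lambda>i. b i + r i * t)) \<in> borel_measurable borel"
      using B measW by (intro borel_measurable_times slab_prob_measurable M) auto
  qed simp
  finally show "(LINT x|M. indicat_real B (X j x) * (\<Prod>i\<in>I. indicat_real {- c i..c i} (X i x + b i))) =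
       (LINT t|distr M borel (X j). indicat_real B t * slab_prob M I W c (\<lambda>i. b i + r i * t))" .
qed

section \<open>Sidak's inequality\<close>

lemma real_distribution_gaussian_measure:
  assumes "0 \<le> s" shows "real_distribution (gaussian_measure \<mu> s)"
  using assms prob_space_return[of \<mu> borel] prob_space_normal_density[of s \<mu>]
  by (auto simp: real_distribution_def real_distribution_axioms_def gaussian_measure_def)

text \<open>Uniqueness of characteristic functions identifies the law in the normal and in the
  degenerate case at once, since \<open>gaussian_measure\<close> admits standard deviation
  0.\<close>

lemma centered_gaussian_distr:
  assumes "prob_space M" "finite I" "centered_gaussian M I X" "j \<in> I"
  shows "distr M borel (X j) = gaussian_measure 0 (sqrt (LINT x|M. (X j x)\<^sup>2))"
proof -
  interpret prob_space M by fact
  have X: "centered_gaussian M {j} X"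
    by (rule centered_gaussian_subset[OF assms(3,2)]) (use assms(4) in auto)
  then have [measurable]: "X j \<in> borel_measurable M" by (simp add: centered_gaussian_def)
  show ?thesis
  proof (rule Levy_uniqueness)
    show "char (distr M borel (X j)) = char (gaussian_measure 0 (sqrt (LINT x|M. (X j x)\<^sup>2)))"
    proof
      fix t
      have "char (distr M borel (X j)) t = (CLINT x|M. iexp (\<Sum>i\<in>{j}. t * X i x))"
        unfolding char_def by (subst integral_distr) auto
      also have "\<dots> = complex_of_real (exp (- (LINT x|M. (\<Sum>i\<in>{j}. t * X i x)\<^sup>2) / 2))"
        using X unfolding centered_gaussian_def by (elim conjE allE[where x="\<lambda>_. t"])
      also have "\<dots> = char (gaussian_measure 0 (sqrt (LINT x|M. (X j x)\<^sup>2))) t"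
        by (subst char_gaussian_measure) (auto simp: power_mult_distrib mult.commute intro!: integral_nonneg_AE)
      finally show "char (distr M borel (X j)) t = char (gaussian_measure 0 (sqrt (LINT x|M. (X j x)\<^sup>2))) t" .
    qed
  qed (auto intro!: real_distribution_gaussian_measure integral_nonneg_AE)
qed

section \<open>Log-concavity of Gaussian slab probabilities\<close>

lemma normal_density_log_concave:
  fixes x y :: real
  assumes s: "0 < s" and l: "0 < l" "l < 1"
  shows "normal_density 0 s x powr (1 - l) * normal_density 0 s y powr l
     \<le> normal_density 0 s ((1 - l) * x + l * y)"
proof -
  define C where "C = 1 / sqrt (2 * pi * s\<^sup>2)"
  have C: "0 < C" unfolding C_def using s by simp
  have nd: "normal_density 0 s u = C * exp (- u\<^sup>2 / (2 * s\<^sup>2))" for u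
    by (simp add: normal_density_def C_def)
  \<comment> \<open>Convexity of the square with its defect made explicit; the defect is
    nonnegative, and the sign in the exponent turns convexity into log-concavity.\<close>
  have "((1 - l) * x + l * y)\<^sup>2 = (1 - l) * x\<^sup>2 + l * y\<^sup>2 - l * (1 - l) * (x - y)\<^sup>2"
    by (simp add: power2_eq_square algebra_simps)
  then have "((1 - l) * x + l * y)\<^sup>2 \<le> (1 - l) * x\<^sup>2 + l * y\<^sup>2" using l by simp
  then have e: "- ((1 - l) * x\<^sup>2 + l * y\<^sup>2) / (2 * s\<^sup>2) \<le> - ((1 - l) * x + l * y)\<^sup>2 / (2 * s\<^sup>2)"
    by (intro divide_right_mono) auto
  have "normal_density 0 s x powr (1 - l) * normal_density 0 s y powr l =
     (C powr (1 - l) * C powr l) * (exp ((1 - l) * (- x\<^sup>2 / (2 * s\<^sup>2))) * exp (l * (- y\<^sup>2 / (2 * s\<^sup>2))))"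
    unfolding nd using C by (simp add: powr_mult exp_powr_real mult_ac)
  also have "\<dots> = C * exp (- ((1 - l) * x\<^sup>2 + l * y\<^sup>2) / (2 * s\<^sup>2))"
    using C s by (simp add: powr_add[symmetric] exp_add[symmetric] field_simps)
  also have "\<dots> \<le> normal_density 0 s ((1 - l) * x + l * y)"
    unfolding nd using C e by simp
  finally show ?thesis .
qed

lemma slab_prob_insert:
  fixes X :: "'i \<Rightarrow> 'a \<Rightarrow> real"
  assumes "finite I" "j \<notin> I"
  shows "slab_prob M (insert j I) X c b =
    (LINT x|M. indicat_real {- c j - b j..c j - b j} (X j x) * (\<Prod>i\<in>I. indicat_real {- c i..c i} (X i x + b i)))"
  unfolding slab_prob_def using assms
  by (intro Bochner_Integration.integral_cong refl) (auto simp: indicator_def)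

text \<open>Given \<open>X j = t\<close>, the remaining slabs are shifted by
  \<open>b i + r i * t\<close>, which is affine in \<open>b\<close> and \<open>t\<close> together.
  By the induction hypothesis their conditional probability is therefore jointly log-concave, as are
  the normal density and the indicator of the moving interval for \<open>X j\<close>, and the
  one-dimensional Prekopa--Leindler inequality integrates \<open>t\<close> out. The shifts must be
  arbitrary in the induction because they carry \<open>t\<close>.\<close>

lemma slab_prob_log_concave:
  fixes X :: "'i \<Rightarrow> 'a \<Rightarrow> real"
  assumes M: "prob_space M" and I: "finite I" and X: "centered_gaussian M I X" and l: "0 < l" "l < 1"
  shows "slab_prob M I X c b powr (1 - l) * slab_prob M I X c b' powr l
     \<le> slab_prob M I X c (\<lambda>i. (1 - l) * b i + l * b' i)"
  using I X
proof (induction I arbitrary: X b b' rule: finite_induct)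
  case empty
  interpret prob_space M by fact
  show ?case by (simp add: slab_prob_def prob_space)
next
  case (insert j I)
  interpret prob_space M by fact
  define r where "r = (\<lambda>i. regression_coeff M (X j) (X i))"
  define W where "W = (\<lambda>i x. X i x - r i * X j x)"
  have W: "centered_gaussian M I W"
    unfolding W_def r_def by (rule gaussian_regression(1)[OF M insert.hyps insert.prems borel_closed[OF closed_UNIV]])
  have reg: "(LINT x|M. indicat_real B (X j x) * (\<Prod>i\<in>I. indicat_real {- c i..c i} (X i x + b i))) =
      (LINT t|distr M borel (X j). indicat_real B t * slab_prob M I W c (\<lambda>i. b i + r i * t))"
    if "B \<in> sets borel" for B b
    unfolding W_def r_def by (rule gaussian_regression(2)[OF M insert.hyps insert.prems that])
  define B where "B b = {- c j - b j..c j - b j}" for b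
  define F where "F b t = slab_prob M I W c (\<lambda>i. b i + r i * t)" for b t
  have F01: "0 \<le> F b t" "F b t \<le> 1" for b t unfolding F_def using slab_prob_bounds[OF M] by auto
  have Fm [measurable]: "F b \<in> borel_measurable borel" for b
    unfolding F_def[abs_def] using W by (intro slab_prob_measurable M) (simp add: centered_gaussian_def)
  have Flc: "F b x powr (1 - l) * F b' y powr l \<le> F (\<lambda>i. (1 - l) * b i + l * b' i) ((1 - l) * x + l * y)" for b b' x y
    using insert.IH[OF W, of "\<lambda>i. b i + r i * x" "\<lambda>i. b' i + r i * y"] unfolding F_def
    by (simp add: algebra_simps)
  have Bm [measurable]: "B b \<in> sets borel" for b by (simp add: B_def)
  have Bc: "(1 - l) * x + l * y \<in> B (\<lambda>i. (1 - l) * b i + l * b' i)" if "x \<in> B b" "y \<in> B b'" for x y b b'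
  proof -
    have "(1 - l) * (- c j - b j) + l * (- c j - b' j) \<le> (1 - l) * x + l * y"
      using that l unfolding B_def by (intro add_mono mult_left_mono) auto
    moreover have "(1 - l) * x + l * y \<le> (1 - l) * (c j - b j) + l * (c j - b' j)"
      using that l unfolding B_def by (intro add_mono mult_left_mono) auto
    ultimately show ?thesis unfolding B_def by (simp add: algebra_simps)
  qed
  define s where "s = sqrt (LINT x|M. (X j x)\<^sup>2)"
  have s: "0 \<le> s" unfolding s_def by (auto intro!: integral_nonneg_AE)
  have slab: "slab_prob M (insert j I) X c b = (LINT t|gaussian_measure 0 s. indicat_real (B b) t * F b t)" for b
    unfolding slab_prob_insert[OF insert.hyps] F_def s_def
      centered_gaussian_distr[OF M _ insert.prems insertI1, symmetric, OF finite.insertI[OF insert.hyps(1)]]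
    unfolding B_def by (rule reg) simp
  let ?b = "\<lambda>i. (1 - l) * b i + l * b' i"
  show ?case
  proof (cases "s = 0")
    case True
    \<comment> \<open>A coordinate of variance 0 sits at the origin and has no density; the
      pointwise inequality at \<open>t = 0\<close> is already the claim.\<close>
    have "slab_prob M (insert j I) X c b = indicat_real (B b) 0 * F b 0" for b
      unfolding slab gaussian_measure_def using True by (simp add: integral_return)
    then show ?thesis
      using Bc[of 0 b 0 b'] Flc[of b 0 b' 0] F01(1)[of ?b 0] by (auto simp: indicator_def)
  next
    case False
    then have s0: "0 < s" using s by simp
    define f where "f b t = normal_density 0 s t * (indicat_real (B b) t * F b t)" for b t
    have fm [measurable]: "f b \<in> borel_measurable borel" for b unfolding f_def[abs_def] by measurable
    have f0: "0 \<le> f b t" for b t unfolding f_def using F01 by simp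
    have fn: "f b t \<le> normal_density 0 s t" for b t
      unfolding f_def using F01[of b t] by (auto simp: indicator_def mult_left_le)
    have slab': "slab_prob M (insert j I) X c b = (LINT t|lborel. f b t)" for b
      unfolding slab gaussian_measure_def f_def using False by (simp add: integral_density)
    have "normal_density 0 s t \<le> 1 / sqrt (2 * pi * s\<^sup>2)" for t
      unfolding normal_density_def using s0 by (simp add: divide_right_mono)
    then have fb: "bdd_above (range (f b))" for b
      using fn by (intro bdd_aboveI[of _ "1 / sqrt (2 * pi * s\<^sup>2)"]) (auto intro: order_trans)
    have fs: "bounded {x. f b x \<noteq> 0}" for b
      by (rule bounded_subset[of "B b"]) (auto simp: B_def f_def indicator_def)
    have fi: "integrable lborel (f b)" for b
      by (rule Bochner_Integration.integrable_bound[of _ "normal_density 0 s"])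
        (use s0 f0 fn in \<open>auto intro!: AE_I2\<close>)
    show ?thesis
      unfolding slab'
    proof (rule prekopa_leindler_real[OF fm fm fm f0 fb fs f0 fb fs f0 fi l])
      fix x y
      show "f b x powr (1 - l) * f b' y powr l \<le> f ?b ((1 - l) * x + l * y)"
      proof (cases "x \<in> B b \<and> y \<in> B b'")
        case True
        have "f b x powr (1 - l) * f b' y powr l =
           (normal_density 0 s x powr (1 - l) * normal_density 0 s y powr l) * (F b x powr (1 - l) * F b' y powr l)"
          using True F01 by (simp add: f_def powr_mult mult_ac)
        also have "\<dots> \<le> normal_density 0 s ((1 - l) * x + l * y) * F ?b ((1 - l) * x + l * y)"
          by (intro mult_mono normal_density_log_concave s0 l Flc) auto
        also have "\<dots> = f ?b ((1 - l) * x + l * y)"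
          using Bc True by (simp add: f_def)
        finally show ?thesis .
      next
        case False
        then have "f b x = 0 \<or> f b' y = 0" by (auto simp: f_def)
        then show ?thesis using f0 by auto
      qed
    qed
  qed
qed

text \<open>If \<open>\<bar>x\<bar> < \<bar>y\<bar>\<close>, then \<open>x\<close> is the convex
  combination of \<open>y\<close> and \<open>- y\<close> with weight \<open>(1 - x / y) / 2\<close>
  on \<open>- y\<close>. The values at \<open>y\<close> and \<open>- y\<close> agree by symmetry, so
  their geometric mean is that common value, and log-concavity bounds it by the value at
  \<open>x\<close>.\<close>

lemma slab_prob_ray_mono:
  assumes M: "prob_space M" and I: "finite I" and X: "centered_gaussian M I X" and xy: "\<bar>x\<bar> \<le> \<bar>y\<bar>"
  shows "slab_prob M I X c (\<lambda>i. r i * y) \<le> slab_prob M I X c (\<lambda>i. r i * x)"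
proof -
  have even: "slab_prob M I X c (\<lambda>i. r i * (- t)) = slab_prob M I X c (\<lambda>i. r i * t)" for t
    using slab_prob_uminus[OF M I X, of c "\<lambda>i. r i * t"] by simp
  show ?thesis
  proof (cases "\<bar>x\<bar> = \<bar>y\<bar>")
    case True
    then have "x = y \<or> x = - y" by linarith
    then show ?thesis using even[of y] by auto
  next
    case False
    then have y: "y \<noteq> 0" "\<bar>x\<bar> < \<bar>y\<bar>" using xy by auto
    define z where "z = x / y"
    define l where "l = (1 - z) / 2"
    have "\<bar>z\<bar> < 1" using y by (simp add: z_def abs_divide)
    then have l: "0 < l" "l < 1" by (auto simp: l_def)
    have eq: "(\<lambda>i. (1 - l) * (r i * y) + l * (r i * (- y))) = (\<lambda>i. r i * x)"
      using y by (auto simp: l_def z_def fun_eq_iff field_simps)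
    let ?p = "slab_prob M I X c (\<lambda>i. r i * y)"
    have "?p = ?p powr (1 - l) * ?p powr l"
      using slab_prob_bounds(1)[OF M, of I X c "\<lambda>i. r i * y"] by (cases "?p = 0") (auto simp: powr_add[symmetric])
    also have "\<dots> \<le> slab_prob M I X c (\<lambda>i. r i * x)"
      using slab_prob_log_concave[OF M I X l, of c "\<lambda>i. r i * y" "\<lambda>i. r i * (- y)"] unfolding even eq by simp
    finally show ?thesis .
  qed
qed

text \<open>Chebyshev's association inequality. With \<open>p\<close> the probability of the slab,
  the product \<open>(?T x - p) * (F (X x) - F c)\<close> is nonnegative pointwise: for
  \<open>c \<ge> 0\<close> both factors change sign at \<open>\<bar>X x\<bar> = c\<close>. The
  threshold \<open>F c\<close> disappears in expectation because \<open>?T x - p\<close> has mean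
  zero. For \<open>c < 0\<close> the slab is empty and the first factor vanishes.\<close>

lemma (in prob_space) indicator_decreasing_correlation:
  fixes F :: "real \<Rightarrow> real"
  assumes X [measurable]: "X \<in> borel_measurable M" and [measurable]: "F \<in> borel_measurable borel"
    and F: "\<And>t. 0 \<le> F t" "\<And>t. F t \<le> 1" "\<And>s t. \<bar>s\<bar> \<le> \<bar>t\<bar> \<Longrightarrow> F t \<le> F s"
  shows "expectation (\<lambda>x. indicat_real {- c..c} (X x)) * expectation (\<lambda>x. F (X x))
    \<le> expectation (\<lambda>x. indicat_real {- c..c} (X x) * F (X x))"
proof -
  let ?T = "\<lambda>x. indicat_real {- c..c} (X x)"
  define p where "p = expectation ?T"
  have iT: "integrable M ?T" by (intro integrable_const_bound[of _ 1]) auto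
  have iF: "integrable M (\<lambda>x. F (X x))" using F by (intro integrable_const_bound[of _ 1]) auto
  have iTF: "integrable M (\<lambda>x. ?T x * F (X x))"
    using F by (intro integrable_const_bound[of _ 1]) (auto simp: indicator_def)
  have p: "0 \<le> p" "p \<le> 1" unfolding p_def
    using iT by (auto intro!: integral_nonneg_AE integral_le_const simp: indicator_def)
  have "0 \<le> expectation (\<lambda>x. (?T x - p) * (F (X x) - F c))"
  proof (intro integral_nonneg_AE AE_I2)
    fix x
    show "0 \<le> (?T x - p) * (F (X x) - F c)"
    proof (cases "X x \<in> {- c..c}")
      case True
      then show ?thesis using p F(3)[of "X x" c] by (auto intro!: mult_nonneg_nonneg simp: abs_if)
    next
      case False
      then have "\<bar>c\<bar> \<le> \<bar>X x\<bar> \<or> c < 0" by auto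
      then show ?thesis
      proof
        assume "\<bar>c\<bar> \<le> \<bar>X x\<bar>"
        then show ?thesis using False p F(3)[of c "X x"] by (auto intro!: mult_nonneg_nonpos)
      next
        assume "c < 0"
        then have "{- c..c} = {}" by auto
        then show ?thesis by (simp add: p_def)
      qed
    qed
  qed
  also have "expectation (\<lambda>x. (?T x - p) * (F (X x) - F c)) =
      expectation (\<lambda>x. ((?T x * F (X x) - F c * ?T x) - p * F (X x)) + p * F c)"
    by (intro Bochner_Integration.integral_cong) (auto simp: algebra_simps)
  also have "\<dots> = expectation (\<lambda>x. ?T x * F (X x)) - F c * p - p * expectation (\<lambda>x. F (X x)) + p * F c"
    using iT iF iTF by (simp add: p_def[symmetric] prob_space)
  finally show ?thesis by (simp add: p_def mult.commute)
qed

theorem sidak: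
  fixes X :: "'i \<Rightarrow> 'a \<Rightarrow> real"
  assumes M: "prob_space M" and I: "finite I" and X: "centered_gaussian M I X"
  shows "(\<Prod>i\<in>I. measure M {x \<in> space M. \<bar>X i x\<bar> \<le> c i}) \<le> measure M {x \<in> space M. \<forall>i\<in>I. \<bar>X i x\<bar> \<le> c i}"
proof -
  interpret prob_space M by fact
  have "(\<Prod>i\<in>I. slab_prob M {i} X c (\<lambda>_. 0)) \<le> slab_prob M I X c (\<lambda>_. 0)"
    using I X
  proof (induction I rule: finite_induct)
    case empty
    then show ?case by (simp add: slab_prob_def prob_space)
  next
    case (insert j I)
    define r where "r = (\<lambda>i. regression_coeff M (X j) (X i))"
    define W where "W = (\<lambda>i x. X i x - r i * X j x)"
    have W: "centered_gaussian M I W"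
      unfolding W_def r_def by (rule gaussian_regression(1)[OF M insert.hyps insert.prems borel_closed[OF closed_UNIV]])
    have reg: "(LINT x|M. indicat_real B (X j x) * (\<Prod>i\<in>I. indicat_real {- c i..c i} (X i x + b i))) =
        (LINT t|distr M borel (X j). indicat_real B t * slab_prob M I W c (\<lambda>i. b i + r i * t))"
      if "B \<in> sets borel" for B b
      unfolding W_def r_def by (rule gaussian_regression(2)[OF M insert.hyps insert.prems that])
    have [measurable]: "X j \<in> borel_measurable M" using insert.prems by (simp add: centered_gaussian_def)
    define F where "F t = slab_prob M I W c (\<lambda>i. r i * t)" for t
    have F01: "0 \<le> F t" "F t \<le> 1" for t unfolding F_def using slab_prob_bounds[OF M] by auto
    have Fm [measurable]: "F \<in> borel_measurable borel"
      using slab_prob_measurable[OF M, of I W c "\<lambda>_. 0" r] W unfolding F_def[abs_def]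
      by (simp add: centered_gaussian_def)
    have Fmono: "F t \<le> F s" if "\<bar>s\<bar> \<le> \<bar>t\<bar>" for s t
      unfolding F_def by (rule slab_prob_ray_mono[OF M insert.hyps(1) W that])
    \<comment> \<open>Taking \<open>UNIV\<close> for \<open>B\<close> gives the probability of the
      other slabs alone, and taking the slab of \<open>X j\<close> gives that of all slabs. Both
      become expectations of the same conditional probability \<open>F\<close>, which reduces the
      induction step to the correlation inequality.\<close>
    have regF: "(LINT x|M. indicat_real B (X j x) * (\<Prod>i\<in>I. indicat_real {- c i..c i} (X i x + 0))) =
        expectation (\<lambda>x. indicat_real B (X j x) * F (X j x))" if [measurable]: "B \<in> sets borel" for B
      using reg[OF that, of "\<lambda>_. 0"] by (simp add: F_def[symmetric] integral_distr)
    have all: "slab_prob M I X c (\<lambda>_. 0) = expectation (\<lambda>x. F (X j x))"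
      using regF[of UNIV] by (simp add: slab_prob_def)
    have one: "slab_prob M {j} X c (\<lambda>_. 0) = expectation (\<lambda>x. indicat_real {- c j..c j} (X j x))"
      by (simp add: slab_prob_def)
    have ins: "slab_prob M (insert j I) X c (\<lambda>_. 0) = expectation (\<lambda>x. indicat_real {- c j..c j} (X j x) * F (X j x))"
      using regF[of "{- c j..c j}"] unfolding slab_prob_insert[OF insert.hyps] by simp
    have "(\<Prod>i\<in>insert j I. slab_prob M {i} X c (\<lambda>_. 0)) =
        slab_prob M {j} X c (\<lambda>_. 0) * (\<Prod>i\<in>I. slab_prob M {i} X c (\<lambda>_. 0))"
      using insert.hyps by simp
    also have "\<dots> \<le> slab_prob M {j} X c (\<lambda>_. 0) * slab_prob M I X c (\<lambda>_. 0)"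
      using insert.hyps centered_gaussian_subset[OF insert.prems, of I]
      by (intro mult_left_mono insert.IH slab_prob_bounds M) auto
    also have "\<dots> \<le> slab_prob M (insert j I) X c (\<lambda>_. 0)"
      unfolding all one ins by (rule indicator_decreasing_correlation) (auto intro: F01 Fmono)
    finally show ?case .
  qed
  moreover have "slab_prob M {i} X c (\<lambda>_. 0) = measure M {x \<in> space M. \<bar>X i x\<bar> \<le> c i}" if "i \<in> I" for i
    using slab_prob_eq_measure[OF M, of "{i}" X c] X that by (simp add: centered_gaussian_def)
  moreover have "slab_prob M I X c (\<lambda>_. 0) = measure M {x \<in> space M. \<forall>i\<in>I. \<bar>X i x\<bar> \<le> c i}"
    using slab_prob_eq_measure[OF M I, of X c] X by (simp add: centered_gaussian_def)
  ultimately show ?thesis by simp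
qed

section \<open>The Gaussian tail\<close>

text \<open>Since \<open>sqrt (u\<^sup>2 + 2) - u = 2 / (u + sqrt (u\<^sup>2 + 2))\<close>, this is, up to a constant, the bound
  in the theorem; its negative derivative dominates the Gaussian density.\<close>

definition tail_bound :: "real \<Rightarrow> real" where
  "tail_bound u = exp (- u\<^sup>2 / 2) * (sqrt (u\<^sup>2 + 2) - u)"

definition tail_density :: "real \<Rightarrow> real" where
  "tail_density u = exp (- u\<^sup>2 / 2) * (1 - u / sqrt (u\<^sup>2 + 2) + u * sqrt (u\<^sup>2 + 2) - u\<^sup>2)"

lemma tail_bound_deriv: "(tail_bound has_real_derivative - tail_density u) (at u)"
proof -
  let ?s = "sqrt (u\<^sup>2 + 2)"
  have pos: "0 < u\<^sup>2 + 2" by (simp add: add_nonneg_pos)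
  have e: "((\<lambda>u. exp (- u\<^sup>2 / 2)) has_real_derivative exp (- u\<^sup>2 / 2) * (- u)) (at u)"
    by (auto intro!: derivative_eq_intros)
  have r: "((\<lambda>u. sqrt (u\<^sup>2 + 2) - u) has_real_derivative (u / ?s - 1)) (at u)"
    using pos by (auto intro!: derivative_eq_intros simp: field_simps)
  show ?thesis
    unfolding tail_bound_def[abs_def]
    by (rule DERIV_cong[OF DERIV_mult[OF e r]])
      (simp add: tail_density_def algebra_simps power2_eq_square)
qed

text \<open>After cancelling the exponential and multiplying by
  \<open>s = sqrt (u\<^sup>2 + 2)\<close>, the claim follows from
  \<open>u * s \<le> u\<^sup>2 + 1\<close>, whose square is
  \<open>u\<^sup>2 * (u\<^sup>2 + 2) \<le> (u\<^sup>2 + 1)\<^sup>2\<close>.\<close>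

lemma exp_le_tail_density:
  assumes "0 \<le> u"
  shows "exp (- u\<^sup>2 / 2) \<le> tail_density u"
proof -
  let ?s = "sqrt (u\<^sup>2 + 2)"
  have pos: "0 < u\<^sup>2 + 2" by (simp add: add_nonneg_pos)
  have s: "0 < ?s" "?s * ?s = u\<^sup>2 + 2" using pos by auto
  have us: "u * ?s \<le> u\<^sup>2 + 1"
  proof (rule power2_le_imp_le)
    have "(u * ?s)\<^sup>2 = u\<^sup>2 * (u\<^sup>2 + 2)" using pos by (simp add: power_mult_distrib)
    also have "\<dots> \<le> (u\<^sup>2 + 1)\<^sup>2" by (simp add: power2_eq_square algebra_simps)
    finally show "(u * ?s)\<^sup>2 \<le> (u\<^sup>2 + 1)\<^sup>2" .
  qed simp
  have "u / ?s + u\<^sup>2 \<le> u * ?s"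
  proof -
    have "(u / ?s + u\<^sup>2) * ?s = u + u * (u * ?s)" using s(1) by (simp add: distrib_right power2_eq_square mult.assoc)
    also have "\<dots> \<le> u + u * (u\<^sup>2 + 1)" using us assms by (intro add_left_mono mult_left_mono)
    also have "\<dots> = (u * ?s) * ?s" unfolding mult.assoc s(2) by (simp add: algebra_simps)
    finally show ?thesis using s(1) by (simp only: mult_le_cancel_right_pos)
  qed
  then show ?thesis unfolding tail_density_def by simp
qed

lemma tail_bound_tendsto_0: "(tail_bound \<longlongrightarrow> 0) at_top"
  unfolding tail_bound_def by real_asymp

text \<open>The majorant is an exact derivative whose primitive vanishes at infinity, so its
  integral is evaluated in closed form.\<close>

lemma nn_integral_gaussian_tail:
  assumes a: "0 \<le> a"
  shows "(\<integral>\<^sup>+u. ennreal (exp (- u\<^sup>2 / 2)) * indicator {a..} u \<partial>lborel) \<le> ennreal (tail_bound a)"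
proof -
  have "(\<integral>\<^sup>+u. ennreal (exp (- u\<^sup>2 / 2)) * indicator {a..} u \<partial>lborel) \<le>
      (\<integral>\<^sup>+u. ennreal (tail_density u) * indicator {a..} u \<partial>lborel)"
  proof (intro nn_integral_mono)
    fix u
    show "ennreal (exp (- u\<^sup>2 / 2)) * indicator {a..} u \<le> ennreal (tail_density u) * indicator {a..} u"
      using a exp_le_tail_density[of u] by (cases "a \<le> u") (auto intro!: ennreal_leI)
  qed
  also have "\<dots> = ennreal (0 - (- tail_bound a))"
  proof (rule nn_integral_FTC_atLeast)
    show "tail_density \<in> borel_measurable borel" unfolding tail_density_def[abs_def] by measurable
    fix x assume "a \<le> x"
    then have x: "0 \<le> x" using a by simp
    show "0 \<le> tail_density x" using exp_le_tail_density[OF x] order_trans[OF exp_ge_zero] by blast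
    show "((\<lambda>u. - tail_bound u) has_real_derivative tail_density x) (at x)"
      using DERIV_minus[OF tail_bound_deriv[of x]] by simp
  next
    show "((\<lambda>u. - tail_bound u) \<longlongrightarrow> 0) at_top" using tendsto_minus[OF tail_bound_tendsto_0] by simp
  qed
  finally show ?thesis by simp
qed

text \<open>The constant \<open>sqrt (8 / pi)\<close> is \<open>4 / sqrt (2 * pi)\<close>: one
  factor 2 for the two tails, another from rationalising \<open>sqrt (a\<^sup>2 + 2) - a\<close>,
  and \<open>1 / sqrt (2 * pi)\<close> from the density.\<close>

lemma (in prob_space) gaussian_slab_ge:
  assumes [measurable]: "X \<in> borel_measurable M"
    and X: "distr M borel X = gaussian_measure 0 \<sigma>" and s: "0 < \<sigma>" and c: "0 \<le> c"
  shows "1 - sqrt (8 / pi) * (exp (- c\<^sup>2 / (2 * \<sigma>\<^sup>2)) / (c / \<sigma> + sqrt (c\<^sup>2 / \<sigma>\<^sup>2 + 2)))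
    \<le> prob {x \<in> space M. \<bar>X x\<bar> \<le> c}"
proof -
  define a where "a = c / \<sigma>"
  have a: "0 \<le> a" using s c by (simp add: a_def)
  have "distr M lborel X = distr M borel X" by (rule distr_cong) auto
  then have "distributed M lborel X (normal_density 0 \<sigma>)"
    using X s by (simp add: distributed_def gaussian_measure_def)
  then have Y: "distributed M lborel (\<lambda>x. X x / \<sigma>) std_normal_density"
    using normal_standard_normal_convert[OF s, of X 0] by simp
  have half: "emeasure M {x \<in> space M. a \<le> X x / \<sigma>} \<le> ennreal (tail_bound a / sqrt (2 * pi))"
  proof -
    have "emeasure M {x \<in> space M. a \<le> X x / \<sigma>} = emeasure M ((\<lambda>x. X x / \<sigma>) -` {a..} \<inter> space M)"
      by (intro arg_cong[where f = "emeasure M"]) auto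
    also have "\<dots> = (\<integral>\<^sup>+u. ennreal (std_normal_density u) * indicator {a..} u \<partial>lborel)"
      by (rule distributed_emeasure[OF Y]) simp
    also have "\<dots> = (\<integral>\<^sup>+u. ennreal (1 / sqrt (2 * pi)) * (ennreal (exp (- u\<^sup>2 / 2)) * indicator {a..} u) \<partial>lborel)"
      by (intro nn_integral_cong) (simp add: std_normal_density_def flip: ennreal_mult' mult.assoc)
    also have "\<dots> = ennreal (1 / sqrt (2 * pi)) * (\<integral>\<^sup>+u. ennreal (exp (- u\<^sup>2 / 2)) * indicator {a..} u \<partial>lborel)"
      by (rule nn_integral_cmult) simp
    also have "\<dots> \<le> ennreal (1 / sqrt (2 * pi)) * ennreal (tail_bound a)"
      by (intro mult_left_mono nn_integral_gaussian_tail a) simp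
    finally show ?thesis by (simp flip: ennreal_mult')
  qed
  have half': "emeasure M {x \<in> space M. X x / \<sigma> \<le> - a} \<le> ennreal (tail_bound a / sqrt (2 * pi))"
  proof -
    have "emeasure M {x \<in> space M. X x / \<sigma> \<le> - a} = emeasure M ((\<lambda>x. X x / \<sigma>) -` {..- a} \<inter> space M)"
      by (intro arg_cong[where f = "emeasure M"]) auto
    also have "\<dots> = (\<integral>\<^sup>+u. ennreal (std_normal_density u) * indicator {..- a} u \<partial>lborel)"
      by (rule distributed_emeasure[OF Y]) simp
    also have "\<dots> = (\<integral>\<^sup>+u. ennreal (std_normal_density (0 + (- 1) * u)) * indicator {..- a} (0 + (- 1) * u) \<partial>lborel)"
      by (subst nn_integral_real_affine[where c = "- 1" and t = 0]) auto
    also have "\<dots> = (\<integral>\<^sup>+u. ennreal (std_normal_density u) * indicator {a..} u \<partial>lborel)"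
      by (intro nn_integral_cong) (auto simp: std_normal_density_def indicator_def)
    also have "\<dots> = emeasure M ((\<lambda>x. X x / \<sigma>) -` {a..} \<inter> space M)"
      by (rule distributed_emeasure[OF Y, symmetric]) simp
    also have "\<dots> = emeasure M {x \<in> space M. a \<le> X x / \<sigma>}"
      by (intro arg_cong[where f = "emeasure M"]) auto
    finally show ?thesis using half by simp
  qed
  have s2: "sqrt (a\<^sup>2 + 2) * sqrt (a\<^sup>2 + 2) = a\<^sup>2 + 2" by (simp add: add_nonneg_nonneg)
  have den: "0 < a + sqrt (a\<^sup>2 + 2)" using a by (simp add: add_nonneg_pos)
  have tb: "tail_bound a = exp (- a\<^sup>2 / 2) * (2 / (a + sqrt (a\<^sup>2 + 2)))"
  proof -
    have "(sqrt (a\<^sup>2 + 2) - a) * (a + sqrt (a\<^sup>2 + 2)) = 2"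
      using s2 by (simp add: algebra_simps power2_eq_square)
    then have "sqrt (a\<^sup>2 + 2) - a = 2 / (a + sqrt (a\<^sup>2 + 2))" using den by (simp add: field_simps)
    then show ?thesis by (simp add: tail_bound_def)
  qed
  have const: "2 * (2 / sqrt (2 * pi)) = sqrt (8 / pi)"
  proof -
    have "sqrt (8 / pi) = sqrt (16 / (2 * pi))" by simp
    also have "\<dots> = 4 / sqrt (2 * pi)" by (simp only: real_sqrt_divide) simp
    finally show ?thesis by simp
  qed
  have tb0: "0 \<le> tail_bound a" unfolding tb using den by simp
  have "2 * (tail_bound a / sqrt (2 * pi)) = (2 * (2 / sqrt (2 * pi))) * (exp (- a\<^sup>2 / 2) / (a + sqrt (a\<^sup>2 + 2)))"
    unfolding tb by simp
  also have "\<dots> = sqrt (8 / pi) * (exp (- c\<^sup>2 / (2 * \<sigma>\<^sup>2)) / (c / \<sigma> + sqrt (c\<^sup>2 / \<sigma>\<^sup>2 + 2)))"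
    unfolding const by (simp add: a_def power_divide)
  finally have q: "2 * (tail_bound a / sqrt (2 * pi)) = sqrt (8 / pi) * (exp (- c\<^sup>2 / (2 * \<sigma>\<^sup>2)) / (c / \<sigma> + sqrt (c\<^sup>2 / \<sigma>\<^sup>2 + 2)))" .
  have h1: "prob {x \<in> space M. a \<le> X x / \<sigma>} \<le> tail_bound a / sqrt (2 * pi)"
    using half tb0 by (simp add: emeasure_eq_measure)
  have h2: "prob {x \<in> space M. X x / \<sigma> \<le> - a} \<le> tail_bound a / sqrt (2 * pi)"
    using half' tb0 by (simp add: emeasure_eq_measure)
  have "1 - prob {x \<in> space M. \<bar>X x\<bar> \<le> c} = prob (space M - {x \<in> space M. \<bar>X x\<bar> \<le> c})"
    by (rule prob_compl[symmetric]) measurable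
  also have "\<dots> \<le> prob ({x \<in> space M. a \<le> X x / \<sigma>} \<union> {x \<in> space M. X x / \<sigma> \<le> - a})"
    using s by (intro finite_measure_mono) (auto simp: a_def field_simps)
  also have "\<dots> \<le> prob {x \<in> space M. a \<le> X x / \<sigma>} + prob {x \<in> space M. X x / \<sigma> \<le> - a}"
    by (rule measure_Un_le) measurable
  also have "\<dots> \<le> 2 * (tail_bound a / sqrt (2 * pi))" using h1 h2 by simp
  finally show ?thesis unfolding q by simp
qed

section \<open>The perturbation of the sinc matrix\<close>

text \<open>The zeros at the nonzero integers make the unperturbed matrix the identity and the
  exponentials of integer frequency orthogonal on \<open>{-pi..pi}\<close>.\<close>

lemma nsinc_of_int: "nsinc (of_int j) = (if j = 0 then 1 else 0)"
  by (simp add: nsinc_def sin_npi_int)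

text \<open>This turns each matrix entry into a Fourier integral over a bounded range of
  \<open>t\<close>, in which the perturbation \<open>x m\<close> appears as a phase
  \<open>x m * t\<close>.\<close>

lemma has_integral_cos_nsinc:
  "((\<lambda>t. cos (y * t)) has_integral 2 * pi * nsinc y) {-pi..pi}"
proof (cases "y = 0")
  case True
  then show ?thesis using has_integral_const_real[of "1::real" "-pi" pi] by (simp add: nsinc_def)
next
  case False
  have "((\<lambda>t. cos (y * t)) has_integral (sin (y * pi) / y - sin (y * (- pi)) / y)) {-pi..pi}"
    by (rule fundamental_theorem_of_calculus)
      (use False in \<open>auto intro!: derivative_eq_intros simp flip: has_real_derivative_iff_has_vector_derivative\<close>)
  also have "sin (y * pi) / y - sin (y * (- pi)) / y = 2 * pi * nsinc y"
    using False by (simp add: nsinc_def mult.commute)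
  finally show ?thesis .
qed

text \<open>The double sum factors into two trigonometric polynomials and a unimodular constant, so
  it is bounded by the product of their moduli whatever the phase \<open>\<theta>\<close>.\<close>

lemma bilinear_cos_eq:
  fixes p v :: "int \<Rightarrow> real"
  shows "(\<Sum>m\<in>I. \<Sum>n\<in>I. p m * v n * cos (of_int (m - n) * t + \<theta>)) =
    Re (cis \<theta> * (\<Sum>m\<in>I. of_real (p m) * cis (of_int m * t)) * cnj (\<Sum>n\<in>I. of_real (v n) * cis (of_int n * t)))"
proof -
  have "cis \<theta> * (\<Sum>m\<in>I. of_real (p m) * cis (of_int m * t)) * cnj (\<Sum>n\<in>I. of_real (v n) * cis (of_int n * t)) =
     (\<Sum>m\<in>I. \<Sum>n\<in>I. of_real (p m * v n) * (cis \<theta> * (cis (of_int m * t) * cis (- (of_int n * t)))))"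
    by (simp add: sum_product sum_distrib_left sum_distrib_right cis_cnj mult_ac)
  also have "\<dots> = (\<Sum>m\<in>I. \<Sum>n\<in>I. of_real (p m * v n) * cis (of_int (m - n) * t + \<theta>))"
    by (intro sum.cong refl) (simp add: cis_mult algebra_simps)
  finally show ?thesis by (simp add: Re_sum)
qed

text \<open>Parseval's identity: in the expanded square only the diagonal survives
  integration.\<close>

lemma trig_poly_has_integral:
  fixes p :: "int \<Rightarrow> real"
  assumes "finite I"
  shows "((\<lambda>t. (cmod (\<Sum>m\<in>I. of_real (p m) * cis (of_int m * t)))\<^sup>2) has_integral 2 * pi * (\<Sum>m\<in>I. (p m)\<^sup>2)) {-pi..pi}"
proof -
  have eq: "(cmod (\<Sum>m\<in>I. of_real (p m) * cis (of_int m * t)))\<^sup>2 = (\<Sum>m\<in>I. \<Sum>n\<in>I. p m * p n * cos (of_int (m - n) * t))" for t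
  proof -
    have norm: "(cmod z)\<^sup>2 = Re (cis 0 * z * cnj z)" for z
      by (simp only: cmod_power2) (simp add: power2_eq_square)
    show ?thesis unfolding norm bilinear_cos_eq[symmetric] by simp
  qed
  have "((\<lambda>t. \<Sum>m\<in>I. \<Sum>n\<in>I. p m * p n * cos (of_int (m - n) * t)) has_integral
     (\<Sum>m\<in>I. \<Sum>n\<in>I. p m * p n * (2 * pi * nsinc (of_int (m - n))))) {-pi..pi}"
    by (intro has_integral_sum assms has_integral_mult_right has_integral_cos_nsinc)
  also have "(\<Sum>m\<in>I. \<Sum>n\<in>I. p m * p n * (2 * pi * nsinc (of_int (m - n)))) = (\<Sum>m\<in>I. \<Sum>n\<in>I. if m = n then 2 * pi * (p m)\<^sup>2 else 0)"
    by (intro sum.cong refl) (simp add: nsinc_of_int power2_eq_square del: of_int_diff)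
  also have "\<dots> = 2 * pi * (\<Sum>m\<in>I. (p m)\<^sup>2)"
    using assms by (simp add: sum.delta sum_distrib_left)
  finally show ?thesis unfolding eq .
qed

text \<open>A weighted arithmetic-geometric mean inequality takes the place of Cauchy--Schwarz. It
  keeps the bound linear in both square sums, and the free weight \<open>a\<close> can be adapted to
  each Taylor term.\<close>

lemma bilinear_cos_integral_le:
  fixes p v :: "int \<Rightarrow> real" and w :: "real \<Rightarrow> real"
  assumes I: "finite I" and a: "0 < a" and w: "continuous_on {-pi..pi} w" "\<And>t. t \<in> {-pi..pi} \<Longrightarrow> \<bar>w t\<bar> \<le> K"
  shows "\<bar>integral {-pi..pi} (\<lambda>t. w t * (\<Sum>m\<in>I. \<Sum>n\<in>I. p m * v n * cos (of_int (m - n) * t + \<theta>)))\<bar>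
    \<le> K * (pi * (a * (\<Sum>m\<in>I. (p m)\<^sup>2) + (\<Sum>m\<in>I. (v m)\<^sup>2) / a))"
proof -
  let ?P = "\<lambda>t. \<Sum>m\<in>I. of_real (p m) * cis (of_int m * t)"
  let ?V = "\<lambda>t. \<Sum>m\<in>I. of_real (v m) * cis (of_int m * t)"
  let ?f = "\<lambda>t. w t * (\<Sum>m\<in>I. \<Sum>n\<in>I. p m * v n * cos (of_int (m - n) * t + \<theta>))"
  let ?g = "\<lambda>t. K * ((a * (cmod (?P t))\<^sup>2 + (cmod (?V t))\<^sup>2 / a) / 2)"
  have K: "0 \<le> K" using w(2)[of 0] by auto
  have g: "(?g has_integral K * ((a * (2 * pi * (\<Sum>m\<in>I. (p m)\<^sup>2)) + (2 * pi * (\<Sum>m\<in>I. (v m)\<^sup>2)) / a) / 2)) {-pi..pi}"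
    by (intro has_integral_mult_right has_integral_divide has_integral_add trig_poly_has_integral I)
  have amgm: "x * y \<le> (a * x\<^sup>2 + y\<^sup>2 / a) / 2" for x y :: real
  proof -
    have "0 \<le> (a * x - y)\<^sup>2 / a" using a by simp
    also have "\<dots> = a * x\<^sup>2 + y\<^sup>2 / a - 2 * (x * y)" using a by (simp add: power2_eq_square field_simps)
    finally show ?thesis by simp
  qed
  have "norm (integral {-pi..pi} ?f) \<le> integral {-pi..pi} ?g"
  proof (rule integral_norm_bound_integral)
    show "?f integrable_on {-pi..pi}"
      by (intro integrable_continuous_interval continuous_intros w)
    show "?g integrable_on {-pi..pi}" using g by blast
    fix t assume t: "t \<in> {-pi..pi}"
    have "\<bar>\<Sum>m\<in>I. \<Sum>n\<in>I. p m * v n * cos (of_int (m - n) * t + \<theta>)\<bar> \<le> cmod (cis \<theta> * ?P t * cnj (?V t))"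
      unfolding bilinear_cos_eq by (rule abs_Re_le_cmod)
    also have "\<dots> = cmod (?P t) * cmod (?V t)" by (simp only: norm_mult norm_cis complex_mod_cnj mult_1)
    also have "\<dots> \<le> (a * (cmod (?P t))\<^sup>2 + (cmod (?V t))\<^sup>2 / a) / 2" by (rule amgm)
    finally show "norm (?f t) \<le> ?g t"
      unfolding real_norm_def abs_mult using w(2)[OF t] K by (intro mult_mono) auto
  qed
  also have "integral {-pi..pi} ?g = K * (pi * (a * (\<Sum>m\<in>I. (p m)\<^sup>2) + (\<Sum>m\<in>I. (v m)\<^sup>2) / a))"
    using integral_unique[OF g] by (simp add: algebra_simps)
  finally show ?thesis by simp
qed

text \<open>The derivatives of the cosine are written as shifts by multiples of
  \<open>pi / 2\<close>, so every Taylor term is again a cosine with a constant phase, the form to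
  which the preceding integral bound applies.\<close>

lemma cos_taylor_bound:
  fixes \<theta> z :: real
  shows "\<bar>cos (\<theta> + z) - (\<Sum>k\<le>n. z ^ k / fact k * cos (\<theta> + of_nat k * (pi / 2)))\<bar> \<le> \<bar>z\<bar> ^ Suc n / fact (Suc n)"
proof -
  have 1: "z ^ k / fact k * cos (\<theta> + of_nat k * (pi / 2)) = Re (cis \<theta> * ((\<i> * z) ^ k / fact k))" for k
  proof -
    have "cis (of_nat k * (pi / 2)) = \<i> ^ k" by (metis Complex.DeMoivre cis_pi_half)
    then have "cis \<theta> * ((\<i> * z) ^ k / fact k) = of_real (z ^ k / fact k) * cis (\<theta> + of_nat k * (pi / 2))"
      by (simp add: power_mult_distrib flip: cis_mult)
    then show ?thesis
      by (simp only: times_complex.sel Re_complex_of_real Im_complex_of_real cis.sel mult_zero_left diff_0_right)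
  qed
  have "cos (\<theta> + z) = Re (cis \<theta> * iexp z)"
    by (simp add: cis_mult flip: cis_conv_exp)
  then have "cos (\<theta> + z) - (\<Sum>k\<le>n. z ^ k / fact k * cos (\<theta> + of_nat k * (pi / 2))) =
    Re (cis \<theta> * (iexp z - (\<Sum>k\<le>n. (\<i> * z) ^ k / fact k)))"
    unfolding 1 by (simp add: right_diff_distrib sum_distrib_left)
  also have "\<bar>\<dots>\<bar> \<le> cmod (cis \<theta> * (iexp z - (\<Sum>k\<le>n. (\<i> * z) ^ k / fact k)))" by (rule abs_Re_le_cmod)
  also have "\<dots> \<le> \<bar>z\<bar> ^ Suc n / fact (Suc n)" using iexp_approx1[of z n] by (simp only: norm_mult norm_cis mult_1)
  finally show ?thesis .
qed

text \<open>The bilinear form of the perturbation is the integral of a trigonometric sum; expanding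
  \<open>cos ((m - n) * t + x m * t)\<close> in powers of \<open>x m * t\<close> absorbs \<open>(x m) ^ k\<close> into the first vector, and
  each resulting term is bounded by Parseval's identity.\<close>

lemma sinc_bilinear_le:
  fixes u v x :: "int \<Rightarrow> real"
  assumes I: "finite I" and c: "0 < c" and x: "\<And>m. m \<in> I \<Longrightarrow> \<bar>x m\<bar> \<le> c" and a: "0 < a"
  shows "(\<Sum>m\<in>I. \<Sum>n\<in>I. u m * v n * (nsinc (of_int (m - n) + x m) - nsinc (of_int (m - n))))
    \<le> (exp (pi * c) - 1) * ((a * (\<Sum>m\<in>I. (u m)\<^sup>2) + (\<Sum>m\<in>I. (v m)\<^sup>2) / a) / 2)"
    (is "?L \<le> (exp (pi * c) - 1) * ?Q")
proof -
  let ?C = "\<lambda>k m n t. cos (of_int (m - n) * t + of_nat k * (pi / 2))"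
  define D where "D t = (\<Sum>m\<in>I. \<Sum>n\<in>I. u m * v n * (cos ((of_int (m - n) + x m) * t) - cos (of_int (m - n) * t)))" for t
  define T where "T k t = (\<Sum>m\<in>I. \<Sum>n\<in>I. u m * v n * ((x m * t) ^ k / fact k * ?C k m n t))" for k t
  \<comment> \<open>A crude constant for the Taylor remainder. It may be large, but it is multiplied
    by \<open>(pi * c) ^ Suc n / fact (Suc n)\<close>, which tends to 0.\<close>
  define A where "A = (\<Sum>m\<in>I. \<Sum>n\<in>I. \<bar>u m * v n\<bar>)"
  have Q: "0 \<le> ?Q" using a by (simp add: sum_nonneg)
  have D: "(D has_integral 2 * pi * ?L) {-pi..pi}"
  proof -
    have "(D has_integral (\<Sum>m\<in>I. \<Sum>n\<in>I. u m * v n * (2 * pi * nsinc (of_int (m - n) + x m) - 2 * pi * nsinc (of_int (m - n))))) {-pi..pi}"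
      unfolding D_def[abs_def]
      by (intro has_integral_sum I has_integral_mult_right has_integral_diff has_integral_cos_nsinc)
    then show ?thesis by (simp add: sum_distrib_left algebra_simps)
  qed
  have Tcont: "continuous_on {-pi..pi} (T k)" for k
    unfolding T_def[abs_def] by (intro continuous_intros) auto
  have T: "\<bar>integral {-pi..pi} (T k)\<bar> \<le> (pi * c) ^ k / fact k * (2 * pi * ?Q)" for k
  proof -
    have eq: "T k t = (t ^ k / fact k) * (\<Sum>m\<in>I. \<Sum>n\<in>I. (u m * x m ^ k) * v n * ?C k m n t)" for t
      unfolding T_def sum_distrib_left by (intro sum.cong refl) (simp add: power_mult_distrib mult_ac)
    \<comment> \<open>The weight is \<open>a / c ^ k\<close> because the powers of
      \<open>x m\<close> can enlarge the square sum of the first vector by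
      \<open>(c ^ k)\<^sup>2\<close>. With this choice both summands carry the same factor
      \<open>c ^ k\<close>, and the bracket \<open>?Q\<close> does not depend on
      \<open>k\<close>.\<close>
    have "\<bar>integral {-pi..pi} (T k)\<bar> \<le> (pi ^ k / fact k) *
        (pi * ((a / c ^ k) * (\<Sum>m\<in>I. (u m * x m ^ k)\<^sup>2) + (\<Sum>m\<in>I. (v m)\<^sup>2) / (a / c ^ k)))"
      unfolding eq[abs_def]
    proof (rule bilinear_cos_integral_le[OF I])
      fix t assume "t \<in> {-pi..pi}"
      then have "\<bar>t\<bar> \<le> pi" by auto
      then show "\<bar>t ^ k / fact k\<bar> \<le> pi ^ k / fact k"
        by (simp add: power_abs divide_right_mono power_mono)
    qed (use a c in \<open>auto intro!: continuous_intros\<close>)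
    also have "\<dots> \<le> (pi ^ k / fact k) * (pi * ((a / c ^ k) * ((c ^ k)\<^sup>2 * (\<Sum>m\<in>I. (u m)\<^sup>2)) + (\<Sum>m\<in>I. (v m)\<^sup>2) / (a / c ^ k)))"
    proof (intro mult_left_mono add_right_mono)
      show "(\<Sum>m\<in>I. (u m * x m ^ k)\<^sup>2) \<le> (c ^ k)\<^sup>2 * (\<Sum>m\<in>I. (u m)\<^sup>2)"
        unfolding sum_distrib_left
      proof (rule sum_mono)
        fix m assume "m \<in> I"
        then have "\<bar>x m ^ k\<bar> \<le> c ^ k" using x by (simp add: power_abs power_mono)
        then have "(x m ^ k)\<^sup>2 \<le> (c ^ k)\<^sup>2" using c by (simp add: abs_le_square_iff[symmetric])
        then show "(u m * x m ^ k)\<^sup>2 \<le> (c ^ k)\<^sup>2 * (u m)\<^sup>2"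
          by (simp add: power_mult_distrib mult.commute mult_left_mono)
      qed
    qed (use a c in auto)
    also have "\<dots> = (pi * c) ^ k / fact k * (2 * pi * ?Q)"
      using a c by (simp add: power_mult_distrib power2_eq_square field_simps)
    finally show ?thesis .
  qed
  have bound: "2 * pi * ?L \<le> (exp (pi * c) - 1) * (2 * pi * ?Q) + 2 * pi * (A * ((pi * c) ^ Suc n / fact (Suc n)))" for n
  proof -
    have int_T: "(\<lambda>t. \<Sum>k\<in>{1..n}. T k t) integrable_on {-pi..pi}"
      by (intro integrable_continuous_interval continuous_intros Tcont)
    have int_D: "D integrable_on {-pi..pi}" using D by blast
    have rem: "\<bar>D t - (\<Sum>k\<in>{1..n}. T k t)\<bar> \<le> A * ((pi * c) ^ Suc n / fact (Suc n))" if "t \<in> {-pi..pi}" for t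
    proof -
      have tp: "\<bar>t\<bar> \<le> pi" using that by auto
      \<comment> \<open>The term of order 0 is the unperturbed cosine, which \<open>D\<close>
        already subtracts. This is the origin of the 1 subtracted from
        \<open>exp (pi * c)\<close>.\<close>
      have split: "(\<Sum>k\<le>n. f k) = f 0 + (\<Sum>k\<in>{1..n}. f k)" for f :: "nat \<Rightarrow> real"
        by (simp add: atMost_atLeast0 sum.atLeast_Suc_atMost)
      have eq: "D t - (\<Sum>k\<in>{1..n}. T k t) = (\<Sum>m\<in>I. \<Sum>n'\<in>I. u m * v n' * (cos (of_int (m - n') * t + x m * t) -
          (\<Sum>k\<le>n. (x m * t) ^ k / fact k * ?C k m n' t)))"
        unfolding D_def T_def split
        by (subst sum.swap, subst sum.swap[of _ I "{1..n}"])
          (simp add: sum_subtractf[symmetric] sum_distrib_left algebra_simps)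
      have "\<bar>D t - (\<Sum>k\<in>{1..n}. T k t)\<bar> \<le> (\<Sum>m\<in>I. \<Sum>n'\<in>I. \<bar>u m * v n'\<bar> * ((pi * c) ^ Suc n / fact (Suc n)))"
        unfolding eq
      proof (rule order_trans[OF sum_abs], rule sum_mono, rule order_trans[OF sum_abs], rule sum_mono)
        fix m n' assume m: "m \<in> I"
        have "\<bar>x m * t\<bar> \<le> pi * c"
          unfolding abs_mult using mult_mono[OF tp x[OF m]] by (simp add: mult.commute)
        then have "\<bar>x m * t\<bar> ^ Suc n / fact (Suc n) \<le> (pi * c) ^ Suc n / fact (Suc n)"
          by (intro divide_right_mono power_mono) auto
        then have "\<bar>cos (of_int (m - n') * t + x m * t) - (\<Sum>k\<le>n. (x m * t) ^ k / fact k * ?C k m n' t)\<bar>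
            \<le> (pi * c) ^ Suc n / fact (Suc n)"
          using cos_taylor_bound[of "of_int (m - n') * t" "x m * t" n] by linarith
        then show "\<bar>u m * v n' * (cos (of_int (m - n') * t + x m * t) - (\<Sum>k\<le>n. (x m * t) ^ k / fact k * ?C k m n' t))\<bar>
            \<le> \<bar>u m * v n'\<bar> * ((pi * c) ^ Suc n / fact (Suc n))"
          unfolding abs_mult[of "u m * v n'"] by (intro mult_left_mono) auto
      qed
      also have "\<dots> = A * ((pi * c) ^ Suc n / fact (Suc n))" unfolding A_def by (simp only: sum_distrib_right)
      finally show ?thesis .
    qed
    have "integral {-pi..pi} D - integral {-pi..pi} (\<lambda>t. \<Sum>k\<in>{1..n}. T k t) =
       integral {-pi..pi} (\<lambda>t. D t - (\<Sum>k\<in>{1..n}. T k t))"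
      using int_D int_T by (simp add: Henstock_Kurzweil_Integration.integral_diff)
    also have "\<dots> \<le> integral {-pi..pi} (\<lambda>t. A * ((pi * c) ^ Suc n / fact (Suc n)))"
      using rem by (intro integral_le integrable_diff int_D int_T integrable_const_ivl) (auto simp: abs_le_iff)
    also have "\<dots> = 2 * pi * (A * ((pi * c) ^ Suc n / fact (Suc n)))" by (simp add: algebra_simps)
    finally have 1: "integral {-pi..pi} D \<le> integral {-pi..pi} (\<lambda>t. \<Sum>k\<in>{1..n}. T k t) + 2 * pi * (A * ((pi * c) ^ Suc n / fact (Suc n)))"
      by simp
    have "integral {-pi..pi} (\<lambda>t. \<Sum>k\<in>{1..n}. T k t) = (\<Sum>k\<in>{1..n}. integral {-pi..pi} (T k))"
      by (intro Henstock_Kurzweil_Integration.integral_sum integrable_continuous_interval Tcont) auto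
    also have "\<dots> \<le> (\<Sum>k\<in>{1..n}. (pi * c) ^ k / fact k * (2 * pi * ?Q))"
      using T by (intro sum_mono) (auto simp: abs_le_iff)
    also have "\<dots> = (\<Sum>k\<in>{1..n}. (pi * c) ^ k / fact k) * (2 * pi * ?Q)" by (simp only: sum_distrib_right)
    also have "\<dots> \<le> (exp (pi * c) - 1) * (2 * pi * ?Q)"
    proof (rule mult_right_mono)
      have "(\<Sum>k<Suc n. (pi * c) ^ k / fact k) \<le> exp (pi * c)"
      proof -
        have s: "(\<lambda>k. (pi * c) ^ k / fact k) sums exp (pi * c)"
          using exp_converges[of "pi * c"] by (simp add: divide_inverse mult.commute)
        show ?thesis
          using sum_le_suminf[OF sums_summable[OF s], of "{..<Suc n}"] c sums_unique[OF s] by simp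
      qed
      moreover have "(\<Sum>k<Suc n. (pi * c) ^ k / fact k) = 1 + (\<Sum>k\<in>{1..n}. (pi * c) ^ k / fact k)"
        by (simp add: lessThan_Suc_atMost atMost_atLeast0 sum.atLeast_Suc_atMost)
      ultimately show "(\<Sum>k\<in>{1..n}. (pi * c) ^ k / fact k) \<le> exp (pi * c) - 1" by simp
    qed (use Q in simp)
    finally show ?thesis using 1 integral_unique[OF D] by simp
  qed
  have lim: "(\<lambda>n. (exp (pi * c) - 1) * (2 * pi * ?Q) + 2 * pi * (A * ((pi * c) ^ Suc n / fact (Suc n)))) \<longlonglongrightarrow>
      (exp (pi * c) - 1) * (2 * pi * ?Q) + 2 * pi * (A * 0)"
  proof (intro tendsto_intros)
    show "(\<lambda>n. (pi * c) ^ Suc n / fact (Suc n)) \<longlonglongrightarrow> 0"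
      using summable_LIMSEQ_zero[OF summable_exp[of "pi * c"]]
      by (intro LIMSEQ_Suc) (simp add: divide_inverse mult.commute)
  qed
  have "2 * pi * ?L \<le> (exp (pi * c) - 1) * (2 * pi * ?Q) + 2 * pi * (A * 0)"
    by (rule LIMSEQ_le_const[OF lim]) (use bound in blast)
  also have "\<dots> = 2 * pi * ((exp (pi * c) - 1) * ?Q)" by simp
  finally show ?thesis by simp
qed

text \<open>The bilinear form is tested with \<open>u\<close> the perturbation of \<open>v\<close>
  itself, which makes it equal to the square sum \<open>U\<close>. The weight \<open>1 / d\<close>
  leaves \<open>U / 2\<close> on the right, which is absorbed and yields
  \<open>U \<le> d\<^sup>2 * V\<close>.\<close>

lemma sinc_perturbation_le:
  fixes v x :: "int \<Rightarrow> real"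
  assumes I: "finite I" and c: "0 < c" and x: "\<And>m. m \<in> I \<Longrightarrow> \<bar>x m\<bar> \<le> c"
  shows "L2_set (\<lambda>m. (\<Sum>n\<in>I. nsinc (of_int (m - n) + x m) * v n) - v m) I \<le> (exp (pi * c) - 1) * L2_set v I"
proof -
  define u where "u m = (\<Sum>n\<in>I. nsinc (of_int (m - n) + x m) * v n) - v m" for m
  define d where "d = exp (pi * c) - 1"
  have d: "0 < d" unfolding d_def using c by simp
  define U where "U = (\<Sum>m\<in>I. (u m)\<^sup>2)"
  define V where "V = (\<Sum>m\<in>I. (v m)\<^sup>2)"
  have u: "u m = (\<Sum>n\<in>I. v n * (nsinc (of_int (m - n) + x m) - nsinc (of_int (m - n))))" if "m \<in> I" for m
    unfolding nsinc_of_int u_def right_diff_distrib sum_subtractf using I that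
    by (simp add: mult.commute if_distrib[of "\<lambda>r. _ * r"] sum.delta cong: if_cong)
  have "U = (\<Sum>m\<in>I. u m * (\<Sum>n\<in>I. v n * (nsinc (of_int (m - n) + x m) - nsinc (of_int (m - n)))))"
    unfolding U_def by (intro sum.cong refl) (simp only: u[symmetric] power2_eq_square)
  also have "\<dots> = (\<Sum>m\<in>I. \<Sum>n\<in>I. u m * v n * (nsinc (of_int (m - n) + x m) - nsinc (of_int (m - n))))"
    by (simp add: sum_distrib_left mult.assoc)
  also have "\<dots> \<le> d * (((1 / d) * U + V / (1 / d)) / 2)"
    unfolding d_def U_def V_def by (rule sinc_bilinear_le[OF I c x]) (use d in \<open>auto simp: d_def\<close>)
  also have "\<dots> = (U + d\<^sup>2 * V) / 2" using d by (simp add: field_simps power2_eq_square)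
  finally have "U \<le> d\<^sup>2 * V" by simp
  then have "sqrt U \<le> sqrt (d\<^sup>2 * V)" by simp
  also have "\<dots> = d * sqrt V" using d by (simp add: real_sqrt_mult)
  finally show ?thesis unfolding L2_set_def U_def V_def d_def u_def .
qed

section \<open>The smallest singular value\<close>

lemma scalar_prod_self_eq: "scalar_prod v v = (\<Sum>i<dim_vec v. (vec_index v i)\<^sup>2)" for v :: "real Matrix.vec"
  by (simp add: scalar_prod_def power2_eq_square atLeast0LessThan)

lemma scalar_prod_self_pos:
  fixes v :: "real Matrix.vec"
  assumes "v \<in> carrier_vec n" "v \<noteq> 0\<^sub>v n"
  shows "0 < scalar_prod v v"
proof -
  obtain i where "i < n" "vec_index v i \<noteq> 0" using assms by (metis carrier_vecD eq_vecI index_zero_vec)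
  then show ?thesis unfolding scalar_prod_self_eq using assms(1) by (intro sum_pos2[of _ i]) auto
qed

lemma gram_eigenvalue_norm:
  fixes A :: "real Matrix.mat"
  assumes A: "A \<in> carrier_mat n n" and v: "eigenvector (transpose_mat A * A) v l"
  shows "l * scalar_prod v v = scalar_prod (A *\<^sub>v v) (A *\<^sub>v v)" "v \<in> carrier_vec n" "v \<noteq> 0\<^sub>v n"
proof -
  show vc: "v \<in> carrier_vec n" and "v \<noteq> 0\<^sub>v n" using v A by (auto simp: eigenvector_def)
  have Av: "A *\<^sub>v v \<in> carrier_vec n" using A vc by simp
  have "(transpose_mat A * A) *\<^sub>v v = transpose_mat A *\<^sub>v (A *\<^sub>v v)"
    by (rule assoc_mult_mat_vec[of _ n n _ n]) (use A vc in auto)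
  then have "transpose_mat A *\<^sub>v (A *\<^sub>v v) = l \<cdot>\<^sub>v v" using v by (simp add: eigenvector_def)
  then have "l * scalar_prod v v = scalar_prod (transpose_mat A *\<^sub>v (A *\<^sub>v v)) v" using vc by simp
  also have "\<dots> = scalar_prod (A *\<^sub>v v) (A *\<^sub>v v)"
    by (rule transpose_vec_mult_scalar[OF A vc Av])
  finally show "l * scalar_prod v v = scalar_prod (A *\<^sub>v v) (A *\<^sub>v v)" .
qed

text \<open>Real and imaginary part of a complex eigenvector satisfy \<open>B p = a p - b q\<close> and
  \<open>B q = b p + a q\<close>; symmetry of \<open>B\<close> forces \<open>b = 0\<close>.\<close>

lemma symmetric_real_eigenvalue:
  fixes B :: "real Matrix.mat"
  assumes B: "B \<in> carrier_mat n n" and n: "0 < n" and sym: "transpose_mat B = B"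
  shows "\<exists>l. eigenvalue B l"
proof -
  let ?C = "map_mat complex_of_real B"
  have C: "?C \<in> carrier_mat n n" using B by simp
  obtain z where "z \<in> spectrum ?C" using spectrum_non_empty[OF C n] by auto
  then obtain w where w: "w \<in> carrier_vec n" "w \<noteq> 0\<^sub>v n" "?C *\<^sub>v w = z \<cdot>\<^sub>v w"
    using C by (auto simp: spectrum_def eigenvalue_def eigenvector_def)
  define p where "p = map_vec Re w"
  define q where "q = map_vec Im w"
  have pq: "p \<in> carrier_vec n" "q \<in> carrier_vec n" using w by (auto simp: p_def q_def)
  have Cw: "vec_index (?C *\<^sub>v w) i = (\<Sum>j<n. of_real (B $$ (i, j)) * vec_index w j)" if "i < n" for i
    using that B w(1) by (simp add: scalar_prod_def atLeast0LessThan)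
  have zi: "(\<Sum>j<n. of_real (B $$ (i, j)) * vec_index w j) = z * vec_index w i" if "i < n" for i
  proof -
    have "(\<Sum>j<n. of_real (B $$ (i, j)) * vec_index w j) = vec_index (z \<cdot>\<^sub>v w) i"
      using Cw[OF that] unfolding w(3) by simp
    then show ?thesis using w(1) that by simp
  qed
  have Bp: "B *\<^sub>v p = Re z \<cdot>\<^sub>v p - Im z \<cdot>\<^sub>v q"
  proof (rule eq_vecI)
    fix i assume "i < dim_vec (Re z \<cdot>\<^sub>v p - Im z \<cdot>\<^sub>v q)"
    then have i: "i < n" using pq by simp
    have "vec_index (B *\<^sub>v p) i = Re (\<Sum>j<n. of_real (B $$ (i, j)) * vec_index w j)"
      using i B w by (simp add: p_def scalar_prod_def atLeast0LessThan)
    then show "vec_index (B *\<^sub>v p) i = vec_index (Re z \<cdot>\<^sub>v p - Im z \<cdot>\<^sub>v q) i"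
      unfolding zi[OF i] using i w by (simp add: p_def q_def)
  qed (use B pq in auto)
  have Bq: "B *\<^sub>v q = Im z \<cdot>\<^sub>v p + Re z \<cdot>\<^sub>v q"
  proof (rule eq_vecI)
    fix i assume "i < dim_vec (Im z \<cdot>\<^sub>v p + Re z \<cdot>\<^sub>v q)"
    then have i: "i < n" using pq by simp
    have "vec_index (B *\<^sub>v q) i = Im (\<Sum>j<n. of_real (B $$ (i, j)) * vec_index w j)"
      using i B w by (simp add: q_def scalar_prod_def atLeast0LessThan)
    then show "vec_index (B *\<^sub>v q) i = vec_index (Im z \<cdot>\<^sub>v p + Re z \<cdot>\<^sub>v q) i"
      unfolding zi[OF i] using i w by (simp add: p_def q_def algebra_simps)
  qed (use B pq in auto)
  have "scalar_prod (B *\<^sub>v q) p = scalar_prod q (B *\<^sub>v p)"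
    using transpose_vec_mult_scalar[OF B pq] sym by simp
  then have "Im z * (scalar_prod p p + scalar_prod q q) = 0"
    unfolding Bp Bq using pq comm_scalar_prod[OF pq]
    by (simp add: add_scalar_prod_distrib[of _ n] scalar_prod_minus_distrib[of _ n] algebra_simps)
  moreover have "0 < scalar_prod p p + scalar_prod q q"
  proof -
    obtain i where "i < n" "vec_index w i \<noteq> 0" using w by (metis carrier_vecD eq_vecI index_zero_vec)
    then have "p \<noteq> 0\<^sub>v n \<or> q \<noteq> 0\<^sub>v n"
      using w(1) by (auto simp: p_def q_def complex_eq_iff dest: arg_cong[where f = "\<lambda>v. vec_index v i"])
    moreover have "0 \<le> scalar_prod p p" "0 \<le> scalar_prod q q"
      unfolding scalar_prod_self_eq by (simp_all add: sum_nonneg)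
    ultimately show ?thesis using scalar_prod_self_pos[OF pq(1)] scalar_prod_self_pos[OF pq(2)] by fastforce
  qed
  ultimately have im: "Im z = 0" by simp
  have "p \<noteq> 0\<^sub>v n \<or> q \<noteq> 0\<^sub>v n"
    using \<open>0 < scalar_prod p p + scalar_prod q q\<close> pq by auto
  then have "eigenvector B p (Re z) \<or> eigenvector B q (Re z)"
    using Bp Bq im B pq by (auto simp: eigenvector_def)
  then show ?thesis by (auto simp: eigenvalue_def)
qed

text \<open>\<open>Min\<close> is meaningful only on a finite nonempty set: the spectrum is finite,
  and symmetry of the Gram matrix provides a real eigenvalue. Since \<open>e\<close> is positive,
  comparing squares is valid without knowing the sign of \<open>l\<close> beforehand.\<close>

lemma le_sigma_min_iff:
  fixes A :: "real Matrix.mat"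
  assumes A: "A \<in> carrier_mat n n" and n: "0 < n" and e: "0 < e"
  shows "e \<le> sigma_min A \<longleftrightarrow> (\<forall>l. eigenvalue (transpose_mat A * A) l \<longrightarrow> e\<^sup>2 \<le> l)"
proof -
  let ?B = "transpose_mat A * A"
  have B: "?B \<in> carrier_mat n n" using A by simp
  have "transpose_mat ?B = ?B" using A by (simp add: transpose_mult[of _ n n _ n])
  then have ne: "singular_values A \<noteq> {}"
    using symmetric_real_eigenvalue[OF B n] by (auto simp: singular_values_def)
  have "singular_values A = sqrt ` spectrum ?B" by (auto simp: singular_values_def spectrum_def)
  then have fin: "finite (singular_values A)" using card_finite_spectrum(1)[OF B] by simp
  have "e \<le> sqrt l \<longleftrightarrow> e\<^sup>2 \<le> l" for l
    using e real_le_rsqrt[of e l] real_sqrt_ge_0_iff[of l] by (metis less_imp_le order_trans real_le_lsqrt real_sqrt_le_iff real_sqrt_unique abs_of_pos real_sqrt_abs)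
  then show ?thesis
    unfolding sigma_min_def Min_ge_iff[OF fin ne] by (auto simp: singular_values_def)
qed

section \<open>Lower bound for the smallest singular value under small perturbations\<close>

lemma bij_betw_centered: "bij_betw (\<lambda>i. int i - int N) {..<2 * N + 1} {- int N..int N}"
  by (rule bij_betwI[where g = "\<lambda>m. nat (m + int N)"]) auto

lemma sinc_matrix_carrier: "sinc_matrix N x \<in> carrier_mat (2 * N + 1) (2 * N + 1)"
  by (simp add: sinc_matrix_def)

text \<open>For an eigenvector of the Gram matrix, the eigenvalue is the squared ratio of the norms
  of its image and of itself. The triangle inequality and the perturbation bound
  \<open>1 - e\<close> show that this ratio is at least \<open>e\<close>.\<close>

lemma sigma_min_sinc_matrix_ge:
  assumes e: "0 < e" "e < 1" and x: "\<And>m. m \<in> {- int N..int N} \<Longrightarrow> \<bar>x m\<bar> \<le> ln (2 - e) / pi"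
  shows "e \<le> sigma_min (sinc_matrix N x)"
proof -
  let ?A = "sinc_matrix N x" and ?I = "{- int N..int N}" and ?n = "2 * N + 1"
  let ?c = "ln (2 - e) / pi"
  have c: "0 < ?c" using e by simp
  have d: "exp (pi * ?c) - 1 = 1 - e" using e by simp
  have "e\<^sup>2 \<le> l" if "eigenvalue (transpose_mat ?A * ?A) l" for l
  proof -
    from that obtain v where "eigenvector (transpose_mat ?A * ?A) v l" by (auto simp: eigenvalue_def)
    note v = gram_eigenvalue_norm[OF sinc_matrix_carrier this]
    define V where "V m = vec_index v (nat (m + int N))" for m
    define W where "W m = (\<Sum>n\<in>?I. nsinc (of_int (m - n) + x m) * V n)" for m
    have vv: "scalar_prod v v = (L2_set V ?I)\<^sup>2"
    proof -
      have "(L2_set V ?I)\<^sup>2 = (\<Sum>m\<in>?I. (V m)\<^sup>2)" by (simp add: L2_set_def sum_nonneg)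
      also have "\<dots> = (\<Sum>i<?n. (V (int i - int N))\<^sup>2)"
        by (rule sum.reindex_bij_betw[OF bij_betw_centered, symmetric])
      also have "\<dots> = scalar_prod v v" using v(2) by (simp add: scalar_prod_self_eq V_def)
      finally show ?thesis ..
    qed
    have Av: "vec_index (?A *\<^sub>v v) i = W (int i - int N)" if "i < ?n" for i
    proof -
      have "W (int i - int N) = (\<Sum>j<?n. nsinc (of_int ((int i - int N) - (int j - int N)) + x (int i - int N)) * V (int j - int N))"
        unfolding W_def by (rule sum.reindex_bij_betw[OF bij_betw_centered, symmetric])
      also have "\<dots> = vec_index (?A *\<^sub>v v) i"
        using that v(2) by (simp add: sinc_matrix_def scalar_prod_def atLeast0LessThan V_def Let_def)
      finally show ?thesis ..
    qed
    have AvAv: "scalar_prod (?A *\<^sub>v v) (?A *\<^sub>v v) = (L2_set W ?I)\<^sup>2"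
    proof -
      have "(L2_set W ?I)\<^sup>2 = (\<Sum>m\<in>?I. (W m)\<^sup>2)" by (simp add: L2_set_def sum_nonneg)
      also have "\<dots> = (\<Sum>i<?n. (W (int i - int N))\<^sup>2)"
        by (rule sum.reindex_bij_betw[OF bij_betw_centered, symmetric])
      also have "\<dots> = (\<Sum>i<?n. (vec_index (?A *\<^sub>v v) i)\<^sup>2)" by (intro sum.cong refl) (simp add: Av)
      also have "\<dots> = scalar_prod (?A *\<^sub>v v) (?A *\<^sub>v v)"
        unfolding scalar_prod_self_eq by (simp add: sinc_matrix_def)
      finally show ?thesis ..
    qed
    have pert: "L2_set (\<lambda>m. W m - V m) ?I \<le> (1 - e) * L2_set V ?I"
      using sinc_perturbation_le[of ?I ?c x V] c x unfolding d W_def by simp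
    have "L2_set V ?I = L2_set (\<lambda>m. W m + (- (W m - V m))) ?I" by simp
    also have "\<dots> \<le> L2_set W ?I + L2_set (\<lambda>m. - (W m - V m)) ?I" by (rule L2_set_triangle_ineq)
    also have "L2_set (\<lambda>m. - (W m - V m)) ?I = L2_set (\<lambda>m. W m - V m) ?I" unfolding L2_set_def by (simp only: power2_minus)
    finally have "e * L2_set V ?I \<le> L2_set W ?I" using pert by (simp add: algebra_simps)
    then have "(e * L2_set V ?I)\<^sup>2 \<le> (L2_set W ?I)\<^sup>2"
      using e by (intro power_mono) (auto simp: L2_set_nonneg)
    then have "e\<^sup>2 * scalar_prod v v \<le> l * scalar_prod v v"
      unfolding v(1)[unfolded AvAv] unfolding vv by (simp add: power_mult_distrib)
    then show "e\<^sup>2 \<le> l" using scalar_prod_self_pos[OF v(2,3)] by simp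
  qed
  then show ?thesis using le_sigma_min_iff[OF sinc_matrix_carrier _ e(1)] by simp
qed

section \<open>Measurability of the singular value event\<close>

lemma sets_Collect_zero_in_Icc:
  fixes f :: "'a \<Rightarrow> real \<Rightarrow> real"
  assumes f [measurable]: "\<And>t. (\<lambda>x. f x t) \<in> borel_measurable M"
    and cont: "\<And>x. continuous_on UNIV (f x)" and ab: "a < b"
  shows "{x \<in> space M. \<exists>t\<in>{a..b}. f x t = 0} \<in> sets M"
proof -
  define Q where "Q = \<rat> \<inter> {a..b}"
  have Q: "countable Q" unfolding Q_def by (simp add: countable_rat)
  \<comment> \<open>On a compact interval a continuous function has a zero iff its modulus takes
    arbitrarily small values at rational points, since the minimum is attained. This replaces an
    uncountable union by countable operations; \<open>a < b\<close> makes the rationals dense in the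
    interval.\<close>
  have iff: "(\<exists>t\<in>{a..b}. f x t = 0) \<longleftrightarrow> (\<forall>n::nat. \<exists>t\<in>Q. \<bar>f x t\<bar> < inverse (real (Suc n)))" for x
  proof
    assume "\<exists>t\<in>{a..b}. f x t = 0"
    then obtain t where t: "t \<in> {a..b}" "f x t = 0" by auto
    show "\<forall>n::nat. \<exists>t\<in>Q. \<bar>f x t\<bar> < inverse (real (Suc n))"
    proof
      fix n :: nat
      have "isCont (f x) t" using cont by (simp add: continuous_on_eq_continuous_at)
      then obtain d where d: "0 < d" "\<And>s. \<bar>s - t\<bar> < d \<Longrightarrow> \<bar>f x s - f x t\<bar> < inverse (real (Suc n))"
        unfolding continuous_at_eps_delta dist_real_def by (metis inverse_positive_iff_positive of_nat_0_less_iff zero_less_Suc)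
      have "max a (t - d) < min b (t + d)" using t ab d(1) by auto
      then obtain r where r: "r \<in> \<rat>" "max a (t - d) < r" "r < min b (t + d)" using Rats_dense_in_real by blast
      then have "r \<in> Q" "\<bar>r - t\<bar> < d" by (auto simp: Q_def)
      then show "\<exists>t\<in>Q. \<bar>f x t\<bar> < inverse (real (Suc n))" using d(2)[of r] t(2) by auto
    qed
  next
    assume A: "\<forall>n::nat. \<exists>t\<in>Q. \<bar>f x t\<bar> < inverse (real (Suc n))"
    have "continuous_on {a..b} (\<lambda>t. \<bar>f x t\<bar>)"
      using cont by (intro continuous_intros) (auto intro: continuous_on_subset)
    then obtain t where t: "t \<in> {a..b}" "\<And>s. s \<in> {a..b} \<Longrightarrow> \<bar>f x t\<bar> \<le> \<bar>f x s\<bar>"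
      using continuous_attains_inf[of "{a..b}" "\<lambda>t. \<bar>f x t\<bar>"] ab by auto
    have "f x t = 0"
    proof (rule ccontr)
      assume "f x t \<noteq> 0"
      then obtain n where "inverse (real (Suc n)) < \<bar>f x t\<bar>" using reals_Archimedean[of "\<bar>f x t\<bar>"] by auto
      moreover obtain s where "s \<in> Q" "\<bar>f x s\<bar> < inverse (real (Suc n))" using A by blast
      ultimately show False using t(2)[of s] by (auto simp: Q_def)
    qed
    then show "\<exists>t\<in>{a..b}. f x t = 0" using t(1) by auto
  qed
  have "{x \<in> space M. \<exists>t\<in>Q. \<bar>f x t\<bar> < inverse (real (Suc n))} \<in> sets M" for n
    by (rule sets.sets_Collect_countable_Ex'[OF _ Q]) measurable
  then show ?thesis unfolding iff by (rule sets.sets_Collect_countable_All)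
qed

lemma sets_Collect_zero_less:
  fixes f :: "'a \<Rightarrow> real \<Rightarrow> real"
  assumes f: "\<And>t. (\<lambda>x. f x t) \<in> borel_measurable M" and cont: "\<And>x. continuous_on UNIV (f x)"
  shows "{x \<in> space M. \<exists>t<b. f x t = 0} \<in> sets M"
proof -
  \<comment> \<open>The open half-line is exhausted by compact intervals; the offset 2 keeps the one
    for \<open>n = 0\<close> from degenerating to a point.\<close>
  have "(\<exists>t<b. f x t = 0) \<longleftrightarrow> (\<exists>n::nat. \<exists>t\<in>{b - real n - 2..b - inverse (real (Suc n))}. f x t = 0)" for x
  proof
    assume "\<exists>t<b. f x t = 0"
    then obtain t where t: "t < b" "f x t = 0" by auto
    obtain k where k: "inverse (real (Suc k)) < b - t" using reals_Archimedean[of "b - t"] t by auto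
    obtain m where m: "b - t \<le> real m" using real_arch_simple by blast
    have "inverse (real (Suc (max k m))) \<le> inverse (real (Suc k))" by (simp add: le_imp_inverse_le)
    then have "t \<le> b - inverse (real (Suc (max k m)))" using k by linarith
    moreover have "real m \<le> real (max k m)" by simp
    then have "b - real (max k m) - 2 \<le> t" using m by linarith
    ultimately have "t \<in> {b - real (max k m) - 2..b - inverse (real (Suc (max k m)))}" by simp
    then show "\<exists>n::nat. \<exists>t\<in>{b - real n - 2..b - inverse (real (Suc n))}. f x t = 0" using t by blast
  next
    assume "\<exists>n::nat. \<exists>t\<in>{b - real n - 2..b - inverse (real (Suc n))}. f x t = 0"
    then obtain n t where "t \<le> b - inverse (real (Suc n))" "f x t = 0" by auto
    moreover have "0 < inverse (real (Suc n))" by simp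
    ultimately show "\<exists>t<b. f x t = 0" by (intro exI[of _ t]) linarith
  qed
  moreover have "b - real n - 2 < b - inverse (real (Suc n))" for n
  proof -
    have "inverse (real (Suc n)) \<le> 1" by (simp add: inverse_le_1_iff)
    then show ?thesis by simp
  qed
  ultimately show ?thesis
    by (simp only:) (intro sets.sets_Collect_countable_Ex sets_Collect_zero_in_Icc f cont)
qed

text \<open>No eigenvalue has to be chosen measurably: the event fails iff the determinant of the
  characteristic matrix has a zero below the square of \<open>e\<close>, and this determinant is
  continuous in \<open>t\<close> and measurable in the sample point.\<close>

lemma sets_sigma_min_ge:
  fixes x :: "int \<Rightarrow> 'a \<Rightarrow> real"
  assumes x: "\<And>m. m \<in> {- int N..int N} \<Longrightarrow> x m \<in> borel_measurable M" and e: "0 < e"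
  shows "{\<omega> \<in> space M. e \<le> sigma_min (sinc_matrix N (\<lambda>m. x m \<omega>))} \<in> sets M"
proof -
  let ?n = "2 * N + 1"
  define A where "A \<omega> = sinc_matrix N (\<lambda>m. x m \<omega>)" for \<omega>
  define B where "B \<omega> = transpose_mat (A \<omega>) * A \<omega>" for \<omega>
  have A: "A \<omega> \<in> carrier_mat ?n ?n" for \<omega> unfolding A_def by (rule sinc_matrix_carrier)
  have B: "B \<omega> \<in> carrier_mat ?n ?n" for \<omega> unfolding B_def using A[of \<omega>] by simp
  define f where "f \<omega> t = Determinant.det (char_matrix (B \<omega>) t)" for \<omega> t
  \<comment> \<open>The Leibniz expansion displays the determinant as a finite sum of products, from
    which measurability in \<open>\<omega>\<close> and continuity in \<open>t\<close> can be read
    off.\<close>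
  have f: "f \<omega> t = (\<Sum>p\<in>{p. p permutes {0..<?n}}. signof p * (\<Prod>i = 0..<?n. B \<omega> $$ (i, p i) - t * of_bool (i = p i)))" for \<omega> t
  proof -
    have "f \<omega> t = (\<Sum>p\<in>{p. p permutes {0..<?n}}. signof p * (\<Prod>i = 0..<?n. char_matrix (B \<omega>) t $$ (i, p i)))"
      unfolding f_def by (rule det_def') (use B in simp)
    also have "\<dots> = (\<Sum>p\<in>{p. p permutes {0..<?n}}. signof p * (\<Prod>i = 0..<?n. B \<omega> $$ (i, p i) - t * of_bool (i = p i)))"
    proof (intro sum.cong refl arg_cong2[where f = "(*)"] prod.cong)
      fix p i assume "p \<in> {p. p permutes {0..<?n}}" "i \<in> {0..<?n}"
      then have "i < ?n" "p i < ?n" by (auto dest: permutes_in_image[where x = i])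
      then show "char_matrix (B \<omega>) t $$ (i, p i) = B \<omega> $$ (i, p i) - t * of_bool (i = p i)"
        using B[of \<omega>] by (simp add: char_matrix_def)
    qed
    finally show ?thesis .
  qed
  have nsinc [measurable]: "nsinc \<in> borel_measurable borel" unfolding nsinc_def[abs_def] by measurable
  have Am: "(\<lambda>\<omega>. A \<omega> $$ (i, j)) \<in> borel_measurable M" if "i < ?n" "j < ?n" for i j
  proof -
    have [measurable]: "x (int i - int N) \<in> borel_measurable M" using that by (intro x) auto
    show ?thesis unfolding A_def sinc_matrix_def using that by (simp add: Let_def)
  qed
  have Bm: "(\<lambda>\<omega>. B \<omega> $$ (i, j)) \<in> borel_measurable M" if "i < ?n" "j < ?n" for i j
  proof -
    have "B \<omega> $$ (i, j) = (\<Sum>k<?n. A \<omega> $$ (k, i) * A \<omega> $$ (k, j))" for \<omega>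
      unfolding B_def using that A[of \<omega>] by (simp add: scalar_prod_def atLeast0LessThan)
    then show ?thesis using that Am by (auto intro!: borel_measurable_sum borel_measurable_times)
  qed
  have "(\<lambda>\<omega>. f \<omega> t) \<in> borel_measurable M" for t
    unfolding f
  proof (intro borel_measurable_sum borel_measurable_times borel_measurable_prod borel_measurable_diff borel_measurable_const)
    fix p i assume "p \<in> {p. p permutes {0..<?n}}" "i \<in> {0..<?n}"
    then have "i < ?n" "p i < ?n" by (auto dest: permutes_in_image[where x = i])
    then show "(\<lambda>\<omega>. B \<omega> $$ (i, p i)) \<in> borel_measurable M" by (rule Bm)
  qed
  moreover have "continuous_on UNIV (f \<omega>)" for \<omega>
    unfolding f[abs_def] by (intro continuous_intros)
  ultimately have "{\<omega> \<in> space M. \<exists>t<e\<^sup>2. f \<omega> t = 0} \<in> sets M" by (rule sets_Collect_zero_less)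
  then have "space M - {\<omega> \<in> space M. \<exists>t<e\<^sup>2. f \<omega> t = 0} \<in> sets M" by simp
  also have "space M - {\<omega> \<in> space M. \<exists>t<e\<^sup>2. f \<omega> t = 0} = {\<omega> \<in> space M. e \<le> sigma_min (A \<omega>)}"
    using le_sigma_min_iff[OF A _ e] eigenvalue_det[OF B] by (auto simp: f_def B_def not_less[symmetric])
  finally show ?thesis unfolding A_def .
qed

section \<open>Combination of the deterministic perturbation bound with Sidak's inequality\<close>

theorem proposition3:
  fixes M :: "'a measure" and \<xi> :: "int \<Rightarrow> 'a \<Rightarrow> real"
    and N :: nat and \<sigma> \<epsilon> \<eta> c q :: real
  assumes "prob_space M"
    and "N \<ge> 1"
    and "\<sigma> > 0"
    and "jointly_gaussian M {- int N..int N} \<xi>"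
    and "\<And>m. m \<in> {- int N..int N} \<Longrightarrow> prob_space.expectation M (\<xi> m) = 0"
    and "\<And>m. m \<in> {- int N..int N} \<Longrightarrow> prob_space.variance M (\<xi> m) = \<sigma>\<^sup>2"
    and "0 < \<epsilon>" "\<epsilon> < 1"
    and "0 < \<eta>" "\<eta> < 1"
    and "c = ln (2 - \<epsilon>) / pi"
    and "q = sqrt (8 / pi) * (exp (- c\<^sup>2 / (2 * \<sigma>\<^sup>2)) / (c / \<sigma> + sqrt (c\<^sup>2 / \<sigma>\<^sup>2 + 2)))"
    and "1 - q > 0"
    and "real N \<le> 1 / 2 * (ln (1 - \<eta>) / ln (1 - q) - 1)"
  shows "prob_space.prob M {\<omega> \<in> space M. sigma_min (sinc_matrix N (\<lambda>m. \<xi> m \<omega>)) \<ge> \<epsilon>} \<ge> 1 - \<eta>"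
proof -
  interpret prob_space M by fact
  let ?I = "{- int N..int N}"
  have c: "0 < c" using assms(7,8,11) by simp
  have X: "centered_gaussian M ?I \<xi>"
    by (rule jointly_gaussian_imp_centered_gaussian[OF assms(1) _ assms(4,5)]) auto
  have meas: "\<xi> m \<in> borel_measurable M" if "m \<in> ?I" for m
    using X that by (simp add: centered_gaussian_def)
  have q0: "0 < q"
  proof -
    have "0 < c / \<sigma> + sqrt (c\<^sup>2 / \<sigma>\<^sup>2 + 2)" using c assms(3) by (simp add: add_pos_nonneg)
    then show ?thesis unfolding assms(12) by simp
  qed
  have slab: "1 - q \<le> prob {\<omega> \<in> space M. \<bar>\<xi> m \<omega>\<bar> \<le> c}" if m: "m \<in> ?I" for m
  proof -
    \<comment> \<open>Mean zero identifies the second moment with the variance, so the standard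
      deviation of the marginal law is \<open>\<sigma>\<close>.\<close>
    have "(LINT \<omega>|M. (\<xi> m \<omega>)\<^sup>2) = \<sigma>\<^sup>2" using assms(5,6)[OF m] by simp
    then have "distr M borel (\<xi> m) = gaussian_measure 0 \<sigma>"
      using centered_gaussian_distr[OF assms(1) _ X m] assms(3) by simp
    then show ?thesis
      unfolding assms(12) using c by (intro gaussian_slab_ge meas[OF m] assms(3)) auto
  qed
  have "1 - \<eta> \<le> (1 - q) ^ (2 * N + 1)"
  proof -
    have lq: "ln (1 - q) < 0" using q0 assms(13) by simp
    have "real (2 * N + 1) \<le> ln (1 - \<eta>) / ln (1 - q)" using assms(14) by simp
    then have "ln (1 - \<eta>) \<le> real (2 * N + 1) * ln (1 - q)" using lq by (simp only: neg_le_divide_eq)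
    also have "\<dots> = ln ((1 - q) ^ (2 * N + 1))" using assms(13) by (simp only: ln_realpow)
    finally show ?thesis using assms(10,13) by (subst (asm) ln_le_cancel_iff) auto
  qed
  also have "\<dots> = (\<Prod>m\<in>?I. 1 - q)"
  proof -
    have "card ?I = 2 * N + 1" by simp
    then show ?thesis by (simp only: prod_constant)
  qed
  also have "\<dots> \<le> (\<Prod>m\<in>?I. prob {\<omega> \<in> space M. \<bar>\<xi> m \<omega>\<bar> \<le> c})"
    using slab assms(13) by (intro prod_mono) auto
  also have "\<dots> \<le> prob {\<omega> \<in> space M. \<forall>m\<in>?I. \<bar>\<xi> m \<omega>\<bar> \<le> c}"
    by (rule sidak[OF assms(1) _ X]) simp
  also have "\<dots> \<le> prob {\<omega> \<in> space M. sigma_min (sinc_matrix N (\<lambda>m. \<xi> m \<omega>)) \<ge> \<epsilon>}"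
  proof (rule finite_measure_mono)
    show "{\<omega> \<in> space M. \<forall>m\<in>?I. \<bar>\<xi> m \<omega>\<bar> \<le> c} \<subseteq> {\<omega> \<in> space M. sigma_min (sinc_matrix N (\<lambda>m. \<xi> m \<omega>)) \<ge> \<epsilon>}"
      unfolding assms(11) by (auto intro!: sigma_min_sinc_matrix_ge assms(7,8))
    show "{\<omega> \<in> space M. sigma_min (sinc_matrix N (\<lambda>m. \<xi> m \<omega>)) \<ge> \<epsilon>} \<in> sets M"
      by (rule sets_sigma_min_ge[OF meas assms(7)])
  qed
  finally show ?thesis .
qed

end
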